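(* Let $\mathfrak g$ be a metric Lie algebra such that $Ann_R(\mathfrak g)$ is totally isotropic. Let $$\mathfrak g=\bigoplus_{i=1}^n\mathfrak g_i=\bigoplus_{j=1}^m\mathfrak g'_j$$ be two decompositions into non-zero, indecomposable, non-degenerate strong ideals. Then $n=m$, and after reordering the factors of the second decomposition, $$\nabla_{\mathfrak g_i}\mathfrak g_i=\nabla_{\mathfrak g_i}\mathfrak g'_i=\nabla_{\mathfrak g'_i}\mathfrak g_i=\nabla_{\mathfrak g'_i}\mathfrak g'_i\quad\text{for all } i,\qquad \nabla_{\mathfrak g_i}\mathfrak g'_j=\nabla_{\mathfrak g'_j}\mathfrak g_i=0\quad\text{for all } i\neq j.$$ Moreover, for each $i$ the restriction $\pi_i:\mathfrak g_i\to\mathfrak g'_i$ of the projection of $\mathfrak g$ onto $\mathfrak g'_i$ along $\bigoplus_{j\neq i}\mathfrak g'_j$ is a strong isometry, and the direct sum $\bigoplus_i\pi_i:\mathfrak g\to\mathfrak g$ is a strong automorphism of $\mathfrak g$.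
   Context: A metric Lie algebra is a finite-dimensional real Lie algebra $\mathfrak g$ with a non-degenerate symmetric bilinear form $\langle\cdot,\cdot\rangle$ (of arbitrary signature). Its Levi-Civita product $\nabla_XY$ is the bilinear product determined by $2\langle\nabla_XY,Z\rangle=\langle[X,Y],Z\rangle-\langle[Y,Z],X\rangle+\langle[Z,X],Y\rangle$. For subspaces, $\nabla_{\mathfrak a}\mathfrak b$ is the linear span of all $\nabla_XY$ with $X\in\mathfrak a$, $Y\in\mathfrak b$. $Ann_R(\mathfrak g)=\{X\in\mathfrak g:\nabla_YX=0\ \forall Y\in\mathfrak g\}$. A subspace is totally isotropic if $\langle X,Y\rangle=0$ for all $X,Y$ in it, and non-degenerate if $\langle\cdot,\cdot\rangle$ restricts to a non-degenerate form on it. A subspace $\mathfrak h$ is a strong ideal if $\nabla_{\mathfrak g}\mathfrak h\subseteq\mathfrak h$ and $\nabla_{\mathfrak h}\mathfrak g\subseteq\mathfrak h$ (strong ideals are Lie ideals). A metric Lie algebra is decomposable if it is a direct sum of two non-zero, non-degenerate strong ideals, and indecomposable otherwise; a non-degenerate strong ideal is called indecomposable if it is so as a metric Lie algebra with the restricted bracket and form. A strong isomorphism is a linear bijection $\pi$ with $\pi(\nabla_XY)=\nabla'_{\pi(X)}\pi(Y)$; a strong automorphism is a strong isomorphism of $\mathfrak g$ onto itself; a strong isometry is a strong isomorphism that also preserves the bilinear forms. On $\mathfrak g_i$ and $\mathfrak g'_i$ the products and forms are those induced by restriction from $\mathfrak g$. *)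

theory Defs
  imports Complex_Main
begin

text \<open>
  A metric Lie algebra lives on a linear subspace of a real vector space. All operations are
  relevant on the carrier only, so that the restriction to a subspace is obtained by merely
  changing the carrier.
\<close>

record 'a mla =
  space_of :: "'a set"
  bracket :: "'a \<Rightarrow> 'a \<Rightarrow> 'a"
  form :: "'a \<Rightarrow> 'a \<Rightarrow> real"

definition restr :: "'a mla \<Rightarrow> 'a set \<Rightarrow> 'a mla" where
  "restr M h = M\<lparr>space_of := h\<rparr>"

definition linear_between ::
  "'a::real_vector set \<Rightarrow> 'b::real_vector set \<Rightarrow> ('a \<Rightarrow> 'b) \<Rightarrow> bool" where
  "linear_between V W f \<longleftrightarrow> f ` V \<subseteq> W \<and>
     (\<forall>x\<in>V. \<forall>y\<in>V. f (x + y) = f x + f y) \<and> (\<forall>c. \<forall>x\<in>V. f (c *\<^sub>R x) = c *\<^sub>R f x)"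

definition nondegenerate_on :: "'a::real_vector mla \<Rightarrow> 'a set \<Rightarrow> bool" where
  "nondegenerate_on M h \<longleftrightarrow> (\<forall>X\<in>h. (\<forall>Y\<in>h. form M X Y = 0) \<longrightarrow> X = 0)"

definition totally_isotropic :: "'a mla \<Rightarrow> 'a set \<Rightarrow> bool" where
  "totally_isotropic M h \<longleftrightarrow> (\<forall>X\<in>h. \<forall>Y\<in>h. form M X Y = 0)"

definition real_lie_algebra :: "'a::real_vector mla \<Rightarrow> bool" where
  "real_lie_algebra M \<longleftrightarrow>
     (\<exists>B. finite B \<and> space_of M = span B) \<and>
     (\<forall>X\<in>space_of M. linear_between (space_of M) (space_of M) (\<lambda>Y. bracket M X Y)) \<and>
     (\<forall>Y\<in>space_of M. linear_between (space_of M) (space_of M) (\<lambda>X. bracket M X Y)) \<and>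
     (\<forall>X\<in>space_of M. bracket M X X = 0) \<and>
     (\<forall>X\<in>space_of M. \<forall>Y\<in>space_of M. \<forall>Z\<in>space_of M.
        bracket M X (bracket M Y Z) + bracket M Y (bracket M Z X)
          + bracket M Z (bracket M X Y) = 0)"

definition metric_lie_algebra :: "'a::real_vector mla \<Rightarrow> bool" where
  "metric_lie_algebra M \<longleftrightarrow> real_lie_algebra M \<and>
     (\<forall>X\<in>space_of M. linear_between (space_of M) UNIV (\<lambda>Y. form M X Y)) \<and>
     (\<forall>Y\<in>space_of M. linear_between (space_of M) UNIV (\<lambda>X. form M X Y)) \<and>
     (\<forall>X\<in>space_of M. \<forall>Y\<in>space_of M. form M X Y = form M Y X) \<and>
     nondegenerate_on M (space_of M)"

text \<open>The Levi-Civita product; see \<open>nabla_iff\<close> below for existence and uniqueness.\<close>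

definition nabla :: "'a::real_vector mla \<Rightarrow> 'a \<Rightarrow> 'a \<Rightarrow> 'a" where
  "nabla M X Y = (THE N. N \<in> space_of M \<and>
     (\<forall>Z\<in>space_of M. 2 * form M N Z =
        form M (bracket M X Y) Z - form M (bracket M Y Z) X + form M (bracket M Z X) Y))"

definition nabla_span :: "'a::real_vector mla \<Rightarrow> 'a set \<Rightarrow> 'a set \<Rightarrow> 'a set" where
  "nabla_span M a b = span {nabla M X Y | X Y. X \<in> a \<and> Y \<in> b}"

definition Ann_R :: "'a::real_vector mla \<Rightarrow> 'a set" where
  "Ann_R M = {X \<in> space_of M. \<forall>Y\<in>space_of M. nabla M Y X = 0}"

definition strong_ideal :: "'a::real_vector mla \<Rightarrow> 'a set \<Rightarrow> bool" where
  "strong_ideal M h \<longleftrightarrow> subspace h \<and> h \<subseteq> space_of M \<and>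
     nabla_span M (space_of M) h \<subseteq> h \<and> nabla_span M h (space_of M) \<subseteq> h"

text \<open>The two summands need not be orthogonal.\<close>

definition decomposable :: "'a::real_vector mla \<Rightarrow> bool" where
  "decomposable M \<longleftrightarrow> (\<exists>a b.
     strong_ideal M a \<and> nondegenerate_on M a \<and> a \<noteq> {0} \<and>
     strong_ideal M b \<and> nondegenerate_on M b \<and> b \<noteq> {0} \<and>
     a \<inter> b = {0} \<and> space_of M = {X + Y | X Y. X \<in> a \<and> Y \<in> b})"

abbreviation indecomposable :: "'a::real_vector mla \<Rightarrow> bool" where
  "indecomposable M \<equiv> \<not> decomposable M"

definition sum_subspaces :: "'i set \<Rightarrow> ('i \<Rightarrow> 'a::real_vector set) \<Rightarrow> 'a set" where
  "sum_subspaces I G = {\<Sum>i\<in>I. x i | x. \<forall>i\<in>I. x i \<in> G i}"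

definition is_direct_sum :: "'a::real_vector set \<Rightarrow> 'i set \<Rightarrow> ('i \<Rightarrow> 'a set) \<Rightarrow> bool" where
  "is_direct_sum V I G \<longleftrightarrow> (\<forall>i\<in>I. subspace (G i)) \<and> V = sum_subspaces I G \<and>
     (\<forall>x. (\<forall>i\<in>I. x i \<in> G i) \<and> (\<Sum>i\<in>I. x i) = 0 \<longrightarrow> (\<forall>i\<in>I. x i = 0))"

definition indecomposable_decomposition ::
  "'a::real_vector mla \<Rightarrow> 'i set \<Rightarrow> ('i \<Rightarrow> 'a set) \<Rightarrow> bool" where
  "indecomposable_decomposition M I G \<longleftrightarrow> is_direct_sum (space_of M) I G \<and>
     (\<forall>i\<in>I. strong_ideal M (G i) \<and> nondegenerate_on M (G i) \<and> G i \<noteq> {0} \<and>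
            indecomposable (restr M (G i)))"

text \<open>Projection onto \<open>a\<close> along \<open>b\<close>, meaningful on \<open>a + b\<close> when the sum is direct.\<close>

definition proj_along :: "'a::real_vector set \<Rightarrow> 'a set \<Rightarrow> 'a \<Rightarrow> 'a" where
  "proj_along a b v = (THE x. x \<in> a \<and> v - x \<in> b)"

definition component :: "'i set \<Rightarrow> ('i \<Rightarrow> 'a::real_vector set) \<Rightarrow> 'i \<Rightarrow> 'a \<Rightarrow> 'a" where
  "component I G i = proj_along (G i) (sum_subspaces (I - {i}) G)"

definition direct_sum_map ::
  "'i set \<Rightarrow> ('i \<Rightarrow> 'a::real_vector set) \<Rightarrow> ('i \<Rightarrow> 'a \<Rightarrow> 'a) \<Rightarrow> 'a \<Rightarrow> 'a" where
  "direct_sum_map I G f v = (\<Sum>i\<in>I. f i (component I G i v))"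

definition strong_isomorphism ::
  "'a::real_vector mla \<Rightarrow> 'b::real_vector mla \<Rightarrow> ('a \<Rightarrow> 'b) \<Rightarrow> bool" where
  "strong_isomorphism M M' f \<longleftrightarrow>
     linear_between (space_of M) (space_of M') f \<and> bij_betw f (space_of M) (space_of M') \<and>
     (\<forall>X\<in>space_of M. \<forall>Y\<in>space_of M. f (nabla M X Y) = nabla M' (f X) (f Y))"

definition strong_isometry ::
  "'a::real_vector mla \<Rightarrow> 'b::real_vector mla \<Rightarrow> ('a \<Rightarrow> 'b) \<Rightarrow> bool" where
  "strong_isometry M M' f \<longleftrightarrow> strong_isomorphism M M' f \<and>
     (\<forall>X\<in>space_of M. \<forall>Y\<in>space_of M. form M' (f X) (f Y) = form M X Y)"

abbreviation strong_automorphism :: "'a::real_vector mla \<Rightarrow> ('a \<Rightarrow> 'a) \<Rightarrow> bool" where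
  "strong_automorphism M f \<equiv> strong_isomorphism M M f"

lemma riesz_nondegenerate:
  fixes M :: "'a::real_vector mla"
  assumes M: "metric_lie_algebra M" and p: "linear_between (space_of M) UNIV (p :: 'a \<Rightarrow> real)"
  shows "\<exists>u\<in>space_of M. \<forall>Z\<in>space_of M. form M u Z = p Z"
proof -
  let ?V = "space_of M"
  obtain B0 where "finite B0" "?V = span B0"
    using M unfolding metric_lie_algebra_def real_lie_algebra_def by blast
  then obtain B where B: "finite B" "?V = span B" "independent B"
  proof -
    obtain B where B: "B \<subseteq> B0" "independent B" "B0 \<subseteq> span B"
      using maximal_independent_subset by blast
    have "span B0 = span B"
      by (rule subset_antisym[OF span_minimal[OF B(3) subspace_span] span_mono[OF B(1)]])
    then show ?thesis
      using that[OF finite_subset[OF B(1) \<open>finite B0\<close>] _ B(2)] \<open>?V = span B0\<close> by simp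
  qed
  have sub: "subspace ?V" using B by simp
  have BV: "B \<subseteq> ?V" using B span_superset by auto
  have f2: "linear_between ?V UNIV (\<lambda>Y. form M X Y)" if "X \<in> ?V" for X
    using M that unfolding metric_lie_algebra_def by blast
  have f1: "linear_between ?V UNIV (\<lambda>X. form M X Y)" if "Y \<in> ?V" for Y
    using M that unfolding metric_lie_algebra_def by blast
  have eqV: "q Z = r Z" if q: "linear_between ?V UNIV (q :: 'a \<Rightarrow> real)"
    and r: "linear_between ?V UNIV r" and e: "\<And>b. b \<in> B \<Longrightarrow> q b = r b" and Z: "Z \<in> ?V" for q r Z
  proof -
    have "Z \<in> span B" using Z B by simp
    then have "Z \<in> ?V \<and> q Z = r Z"
    proof (induction rule: span_induct_alt)
      case base
      have "0 *\<^sub>R (0::'a) = 0" by simp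
      then have "q 0 = 0" "r 0 = 0"
        using q r subspace_0[OF sub] unfolding linear_between_def
        by (metis scale_zero_left)+
      then show ?case using subspace_0[OF sub] by simp
    next
      case (step c x y)
      have xV: "x \<in> ?V" using step BV by blast
      have cx: "c *\<^sub>R x \<in> ?V" using xV sub subspace_scale by blast
      have "q (c *\<^sub>R x + y) = c *\<^sub>R q x + q y" "r (c *\<^sub>R x + y) = c *\<^sub>R r x + r y"
        using q r cx step xV unfolding linear_between_def by auto
      then show ?case using step e cx sub subspace_add by auto
    qed
    then show ?thesis by simp
  qed
  define T where "T v = (\<Sum>b\<in>B. form M v b *\<^sub>R b)" for v
  define S where "S = construct B T"
  have S: "linear S" "\<And>b. b \<in> B \<Longrightarrow> S b = T b"
    using B unfolding S_def by (auto simp: linear_construct construct_basis)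
  have ST: "S v = T v" if "v \<in> ?V" for v
  proof -
    have "v \<in> span B" using that B by simp
    then have "v \<in> ?V \<and> S v = T v"
    proof (induction rule: span_induct_alt)
      case base
      have "form M 0 b = 0" if "b \<in> B" for b
        using f1[of b] BV that subspace_0[OF sub] unfolding linear_between_def
        by (metis scale_zero_left subsetD)
      then show ?case using S subspace_0[OF sub] by (simp add: T_def linear_0)
    next
      case (step c x y)
      have xV: "x \<in> ?V" using step BV by blast
      have cx: "c *\<^sub>R x \<in> ?V" using xV sub subspace_scale by blast
      have "form M (c *\<^sub>R x + y) b = c * form M x b + form M y b" if "b \<in> B" for b
        using f1[of b] BV that cx xV step unfolding linear_between_def by auto
      then have "T (c *\<^sub>R x + y) = c *\<^sub>R T x + T y"
        by (simp add: T_def scaleR_left_distrib sum.distrib scaleR_sum_right)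
      moreover have "S (c *\<^sub>R x + y) = c *\<^sub>R S x + S y"
        using S(1) by (simp add: linear_add linear_scale)
      ultimately show ?case using step S(2) cx sub subspace_add by auto
    qed
    then show ?thesis by simp
  qed
  have coef: "g b = 0" if "(\<Sum>b\<in>B. g b *\<^sub>R b) = 0" "b \<in> B" for g b
    using B that independentD[of B B g b] by auto
  have ker: "v = 0" if v: "v \<in> ?V" "S v = 0" for v
  proof -
    have "form M v b = 0" if "b \<in> B" for b
      using coef[of "\<lambda>b. form M v b" b] v ST that by (simp add: T_def)
    then have "form M v Z = 0" if "Z \<in> ?V" for Z
      using eqV[OF f2[OF v(1)], of "\<lambda>_. 0"] that by (simp add: linear_between_def)
    then show ?thesis
      using M v unfolding metric_lie_algebra_def nondegenerate_on_def by blast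
  qed
  have inj: "inj_on S (span B)"
  proof (rule inj_onI)
    fix x y assume "x \<in> span B" "y \<in> span B" "S x = S y"
    then have "x - y \<in> ?V" "S (x - y) = 0"
      using B(2) S(1) by (auto simp: span_diff linear_diff)
    then show "x = y" using ker[of "x - y"] by simp
  qed
  have ind: "independent (S ` B)"
    by (rule linear_independent_injective_image[OF S(1) B(3) inj])
  have card: "card (S ` B) = card B"
    using inj span_superset card_image inj_on_subset by metis
  have Tin: "T v \<in> span B" for v
    unfolding T_def by (intro span_sum span_scale span_base)
  have SB: "S ` B \<subseteq> span B" using S(2) Tin by auto
  have "b \<in> span (S ` B)" if b: "b \<in> B" for b
  proof (rule ccontr)
    assume n: "b \<notin> span (S ` B)"
    then have "independent (insert b (S ` B))" using ind by (rule independent_insertI)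
    moreover have "insert b (S ` B) \<subseteq> span B" using SB b span_base[of b B] by simp
    ultimately have "card (insert b (S ` B)) \<le> card B"
      using independent_span_bound[OF B(1)] by blast
    moreover have "b \<notin> S ` B" using n span_base[of b "S ` B"] by blast
    ultimately show False using card B(1) by simp
  qed
  then have sp: "span B \<subseteq> span (S ` B)" by (simp add: span_minimal subsetI)
  have "(\<Sum>b\<in>B. p b *\<^sub>R b) \<in> span B" by (intro span_sum span_scale span_base)
  then have "(\<Sum>b\<in>B. p b *\<^sub>R b) \<in> S ` span B"
    using sp linear_span_image[OF S(1)] by blast
  then obtain u where u: "u \<in> ?V" "S u = (\<Sum>b\<in>B. p b *\<^sub>R b)" using B by auto
  then have "(\<Sum>b\<in>B. (form M u b - p b) *\<^sub>R b) = 0"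
    using ST by (simp add: T_def scaleR_left_diff_distrib sum_subtractf)
  then have "form M u b = p b" if "b \<in> B" for b
    using coef[of "\<lambda>b. form M u b - p b" b] that by simp
  then show ?thesis using eqV[OF f2[OF u(1)] p] u by blast
qed

lemma mla_facts:
  fixes M :: "'a::real_vector mla"
  assumes "metric_lie_algebra M"
  shows "subspace (space_of M)"
    and "\<And>X Y. X \<in> space_of M \<Longrightarrow> Y \<in> space_of M \<Longrightarrow> bracket M X Y \<in> space_of M"
    and "\<And>X Y Z. \<lbrakk>X \<in> space_of M; Y \<in> space_of M; Z \<in> space_of M\<rbrakk> \<Longrightarrow>
           bracket M (X + Y) Z = bracket M X Z + bracket M Y Z"
    and "\<And>X Y Z. \<lbrakk>X \<in> space_of M; Y \<in> space_of M; Z \<in> space_of M\<rbrakk> \<Longrightarrow>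
           bracket M Z (X + Y) = bracket M Z X + bracket M Z Y"
    and "\<And>c X Z. \<lbrakk>X \<in> space_of M; Z \<in> space_of M\<rbrakk> \<Longrightarrow>
           bracket M (c *\<^sub>R X) Z = c *\<^sub>R bracket M X Z"
    and "\<And>c X Z. \<lbrakk>X \<in> space_of M; Z \<in> space_of M\<rbrakk> \<Longrightarrow>
           bracket M Z (c *\<^sub>R X) = c *\<^sub>R bracket M Z X"
    and "\<And>X Y Z. \<lbrakk>X \<in> space_of M; Y \<in> space_of M; Z \<in> space_of M\<rbrakk> \<Longrightarrow>
           form M (X + Y) Z = form M X Z + form M Y Z"
    and "\<And>c X Z. \<lbrakk>X \<in> space_of M; Z \<in> space_of M\<rbrakk> \<Longrightarrow>
           form M (c *\<^sub>R X) Z = c * form M X Z"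
    and "\<And>X Y. X \<in> space_of M \<Longrightarrow> Y \<in> space_of M \<Longrightarrow> form M X Y = form M Y X"
    and "\<And>X Y. X \<in> space_of M \<Longrightarrow> Y \<in> space_of M \<Longrightarrow> bracket M X Y = - bracket M Y X"
proof -
  have L1: "\<And>X. X \<in> space_of M \<Longrightarrow>
        linear_between (space_of M) (space_of M) (\<lambda>Y. bracket M X Y)"
    and L2: "\<And>Y. Y \<in> space_of M \<Longrightarrow>
        linear_between (space_of M) (space_of M) (\<lambda>X. bracket M X Y)"
    and L3: "\<And>Y. Y \<in> space_of M \<Longrightarrow> linear_between (space_of M) UNIV (\<lambda>X. form M X Y)"
    using assms unfolding metric_lie_algebra_def real_lie_algebra_def by simp_all
  show s: "subspace (space_of M)"
    using assms unfolding metric_lie_algebra_def real_lie_algebra_def by auto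
  show br: "\<And>X Y. X \<in> space_of M \<Longrightarrow> Y \<in> space_of M \<Longrightarrow> bracket M X Y \<in> space_of M"
    using L1 L2 unfolding linear_between_def by (auto simp: image_subset_iff)
  show a1: "\<And>X Y Z. \<lbrakk>X \<in> space_of M; Y \<in> space_of M; Z \<in> space_of M\<rbrakk> \<Longrightarrow>
           bracket M (X + Y) Z = bracket M X Z + bracket M Y Z"
    using L1 L2 unfolding linear_between_def by (auto simp: image_subset_iff)
  show a2: "\<And>X Y Z. \<lbrakk>X \<in> space_of M; Y \<in> space_of M; Z \<in> space_of M\<rbrakk> \<Longrightarrow>
           bracket M Z (X + Y) = bracket M Z X + bracket M Z Y"
    using L1 L2 unfolding linear_between_def by (auto simp: image_subset_iff)
  show "\<And>c X Z. \<lbrakk>X \<in> space_of M; Z \<in> space_of M\<rbrakk> \<Longrightarrow>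
           bracket M (c *\<^sub>R X) Z = c *\<^sub>R bracket M X Z"
    using L1 L2 unfolding linear_between_def by (auto simp: image_subset_iff)
  show "\<And>c X Z. \<lbrakk>X \<in> space_of M; Z \<in> space_of M\<rbrakk> \<Longrightarrow>
           bracket M Z (c *\<^sub>R X) = c *\<^sub>R bracket M Z X"
    using L1 L2 unfolding linear_between_def by (auto simp: image_subset_iff)
  show "\<And>X Y Z. \<lbrakk>X \<in> space_of M; Y \<in> space_of M; Z \<in> space_of M\<rbrakk> \<Longrightarrow>
           form M (X + Y) Z = form M X Z + form M Y Z"
    using L3 unfolding linear_between_def by simp
  show "\<And>c X Z. \<lbrakk>X \<in> space_of M; Z \<in> space_of M\<rbrakk> \<Longrightarrow>
           form M (c *\<^sub>R X) Z = c * form M X Z"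
    using L3 unfolding linear_between_def by simp
  show "\<And>X Y. X \<in> space_of M \<Longrightarrow> Y \<in> space_of M \<Longrightarrow> form M X Y = form M Y X"
    using assms unfolding metric_lie_algebra_def by blast
  fix X Y assume XY: "X \<in> space_of M" "Y \<in> space_of M"
  have z: "bracket M W W = 0" if "W \<in> space_of M" for W
    using assms that unfolding metric_lie_algebra_def real_lie_algebra_def by blast
  have XYs: "X + Y \<in> space_of M" using XY s subspace_add by blast
  have "bracket M (X + Y) (X + Y) = bracket M X Y + bracket M Y X"
    using a1[OF XY XYs] a2[OF XY XY(1)] a2[OF XY XY(2)] z XY by simp
  then show "bracket M X Y = - bracket M Y X" using z[OF XYs] by (simp add: eq_neg_iff_add_eq_0)
qed

lemma nabla_iff:
  assumes M: "metric_lie_algebra M" and X: "X \<in> space_of M" and Y: "Y \<in> space_of M"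
  shows "N = nabla M X Y \<longleftrightarrow> N \<in> space_of M \<and>
     (\<forall>Z\<in>space_of M. 2 * form M N Z =
        form M (bracket M X Y) Z - form M (bracket M Y Z) X + form M (bracket M Z X) Y)"
proof -
  note F = mla_facts[OF M]
  define p where "p Z = (form M (bracket M X Y) Z - form M (bracket M Y Z) X
                            + form M (bracket M Z X) Y) / 2" for Z
  have f2: "form M W (Z + Z') = form M W Z + form M W Z'"
    if "W \<in> space_of M" "Z \<in> space_of M" "Z' \<in> space_of M" for W Z Z'
    using F(7)[OF that(2,3,1)] F(9) F(1) that subspace_add by metis
  have f3: "form M W (c *\<^sub>R Z) = c * form M W Z"
    if "W \<in> space_of M" "Z \<in> space_of M" for W Z c
    using F(8)[OF that(2,1)] F(9) F(1) that subspace_scale by metis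
  have "linear_between (space_of M) UNIV p"
    unfolding linear_between_def p_def
    using X Y by (auto simp: F(2-8) f2 f3 field_simps)
  then obtain u where u: "u \<in> space_of M" "\<forall>Z\<in>space_of M. form M u Z = p Z"
    using riesz_nondegenerate[OF M] by blast
  let ?P = "\<lambda>N. N \<in> space_of M \<and> (\<forall>Z\<in>space_of M. 2 * form M N Z =
        form M (bracket M X Y) Z - form M (bracket M Y Z) X + form M (bracket M Z X) Y)"
  have pu: "?P u" using u by (simp add: p_def mult.commute)
  have un: "N = u" if N: "?P N" for N
  proof -
    have d: "N - u \<in> space_of M" using N u F(1) subspace_diff by blast
    have "form M (N - u) Z = 0" if Z: "Z \<in> space_of M" for Z
    proof -
      have "form M N Z = form M u Z" using N pu Z by fastforce
      moreover have "form M ((N - u) + u) Z = form M (N - u) Z + form M u Z"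
        using F(7)[OF d u(1) Z] .
      ultimately show ?thesis by simp
    qed
    then have "N - u = 0"
      using M d unfolding metric_lie_algebra_def nondegenerate_on_def by blast
    then show ?thesis by simp
  qed
  have nu: "nabla M X Y = u" unfolding nabla_def by (rule the_equality[of ?P, OF pu un])
  show ?thesis
  proof
    assume "N = nabla M X Y"
    then have "N = u" using nu by (rule trans)
    then show "?P N" using pu by (rule ssubst)
  next
    assume "?P N"
    then have "N = u" by (rule un)
    then show "N = nabla M X Y" using nu by simp
  qed
qed

text \<open>On a non-degenerate strong ideal, restricting bracket and form yields again a metric Lie
  algebra, and its Levi-Civita product is the restriction of the ambient one.\<close>

lemma restr_strong_ideal:
  assumes M: "metric_lie_algebra M" and h: "strong_ideal M h" and nd: "nondegenerate_on M h"
  shows "metric_lie_algebra (restr M h)"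
    and "\<And>X Y. X \<in> h \<Longrightarrow> Y \<in> h \<Longrightarrow> nabla (restr M h) X Y = nabla M X Y"
proof -
  note F = mla_facts[OF M]
  have hs: "subspace h" and hV: "h \<subseteq> space_of M" using h by (auto simp: strong_ideal_def)
  have nh: "nabla M X Y \<in> h" if "X \<in> h" "Y \<in> space_of M" for X Y
  proof -
    have "nabla M X Y \<in> nabla_span M h (space_of M)"
      unfolding nabla_span_def by (rule span_base) (use that in blast)
    then show ?thesis using h by (auto simp: strong_ideal_def)
  qed
  have brh: "bracket M X Y \<in> h" if XY: "X \<in> h" "Y \<in> h" for X Y
  proof -
    have V: "X \<in> space_of M" "Y \<in> space_of M" using XY hV by auto
    let ?a = "nabla M X Y" and ?b = "nabla M Y X"
    have a: "?a \<in> space_of M" "\<And>Z. Z \<in> space_of M \<Longrightarrow> 2 * form M ?a Z =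
        form M (bracket M X Y) Z - form M (bracket M Y Z) X + form M (bracket M Z X) Y"
      using nabla_iff[OF M V] by blast+
    have b: "?b \<in> space_of M" "\<And>Z. Z \<in> space_of M \<Longrightarrow> 2 * form M ?b Z =
        form M (bracket M Y X) Z - form M (bracket M X Z) Y + form M (bracket M Z Y) X"
      using nabla_iff[OF M V(2,1)] by blast+
    have neg: "form M (bracket M P Q) R = - form M (bracket M Q P) R"
      if "P \<in> space_of M" "Q \<in> space_of M" "R \<in> space_of M" for P Q R
      using F(10)[OF that(1,2)] F(8)[of "bracket M Q P" R "-1"] F(2) that by simp
    define d where "d = ?a + (-1) *\<^sub>R ?b + (-1) *\<^sub>R bracket M X Y"
    have s: "(-1) *\<^sub>R ?b \<in> space_of M" "(-1) *\<^sub>R bracket M X Y \<in> space_of M"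
      "?a + (-1) *\<^sub>R ?b \<in> space_of M" "d \<in> space_of M"
      unfolding d_def
      by (intro subspace_add[OF F(1)] subspace_scale[OF F(1)] a(1) b(1) F(2) V)+
    have "form M d Z = 0" if Z: "Z \<in> space_of M" for Z
    proof -
      have "form M d Z = form M ?a Z - form M ?b Z - form M (bracket M X Y) Z"
        unfolding d_def
        using F(7)[OF s(3,2) Z] F(7)[OF a(1) s(1) Z] F(8)[OF b(1) Z, of "-1"]
          F(8)[OF F(2)[OF V] Z, of "-1"] by simp
      then show ?thesis
        using a(2)[OF Z] b(2)[OF Z] neg[OF V Z] neg[OF V(1) Z V(2)] neg[OF V(2) Z V(1)]
        by linarith
    qed
    then have "d = 0"
      using M s(4) unfolding metric_lie_algebra_def nondegenerate_on_def by blast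
    then have "bracket M X Y = ?a - ?b" by (simp add: d_def algebra_simps)
    then show ?thesis using nh V XY hs subspace_diff by metis
  qed
  obtain B where B: "finite B" "space_of M = span B"
    using M unfolding metric_lie_algebra_def real_lie_algebra_def by blast
  obtain C where C: "C \<subseteq> h" "independent C" "h \<subseteq> span C"
    using maximal_independent_subset by blast
  have "finite C" using independent_span_bound[OF B(1) C(2)] C hV B by auto
  moreover have "h = span C" using C hs span_minimal by blast
  ultimately have fd: "\<exists>B. finite B \<and> h = span B" by blast
  show R: "metric_lie_algebra (restr M h)"
    unfolding metric_lie_algebra_def real_lie_algebra_def
  proof (intro conjI ballI)
    note U = M[unfolded metric_lie_algebra_def real_lie_algebra_def]
    have sl: "linear_between h UNIV f" if "linear_between (space_of M) UNIV f" for f :: "'a \<Rightarrow> real"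
      using that hV unfolding linear_between_def
      by (intro conjI ballI allI image_subsetI) (simp_all add: subsetD[OF hV])
    have sp: "space_of (restr M h) = h" "bracket (restr M h) = bracket M"
      "form (restr M h) = form M" by (simp_all add: restr_def)
    show "\<exists>B. finite B \<and> space_of (restr M h) = span B" using fd by (simp add: sp)
    show "nondegenerate_on (restr M h) (space_of (restr M h))"
      using nd by (simp add: nondegenerate_on_def sp)
    fix X assume "X \<in> space_of (restr M h)"
    then have X: "X \<in> h" "X \<in> space_of M" using hV by (auto simp: sp)
    show "linear_between (space_of (restr M h)) (space_of (restr M h)) (bracket (restr M h) X)"
      unfolding linear_between_def sp
      by (intro conjI ballI allI image_subsetI) (simp_all add: F(4,6) X brh subsetD[OF hV])
    show "linear_between (space_of (restr M h)) (space_of (restr M h))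
            (\<lambda>Y. bracket (restr M h) Y X)"
      unfolding linear_between_def sp
      by (intro conjI ballI allI image_subsetI) (simp_all add: F(3,5) X brh subsetD[OF hV])
    show "linear_between (space_of (restr M h)) UNIV (form (restr M h) X)"
      unfolding sp by (rule sl) (use U X in simp)
    show "linear_between (space_of (restr M h)) UNIV (\<lambda>Y. form (restr M h) Y X)"
      unfolding sp by (rule sl) (use U X in simp)
    show "bracket (restr M h) X X = 0" using U X by (simp add: sp)
    fix Y assume "Y \<in> space_of (restr M h)"
    then have Y: "Y \<in> space_of M" using hV by (auto simp: sp)
    show "form (restr M h) X Y = form (restr M h) Y X" using F(9)[OF X(2) Y] by (simp add: sp)
    fix Z assume "Z \<in> space_of (restr M h)"
    then have Z: "Z \<in> space_of M" using hV by (auto simp: sp)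
    show "bracket (restr M h) X (bracket (restr M h) Y Z)
        + bracket (restr M h) Y (bracket (restr M h) Z X)
        + bracket (restr M h) Z (bracket (restr M h) X Y) = 0"
      using U X Y Z by (simp add: sp)
  qed
  show "nabla (restr M h) X Y = nabla M X Y" if XY: "X \<in> h" "Y \<in> h" for X Y
  proof -
    have V: "X \<in> space_of M" "Y \<in> space_of M" using XY hV by auto
    have "nabla M X Y = nabla (restr M h) X Y"
    proof (rule nabla_iff[OF R, THEN iffD2])
      have "\<forall>Z\<in>space_of M. 2 * form M (nabla M X Y) Z =
        form M (bracket M X Y) Z - form M (bracket M Y Z) X + form M (bracket M Z X) Y"
        using nabla_iff[OF M V] by blast
      then show "nabla M X Y \<in> space_of (restr M h) \<and>
          (\<forall>Z\<in>space_of (restr M h). 2 * form (restr M h) (nabla M X Y) Z =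
            form (restr M h) (bracket (restr M h) X Y) Z
            - form (restr M h) (bracket (restr M h) Y Z) X
            + form (restr M h) (bracket (restr M h) Z X) Y)"
        using nh[OF XY(1) V(2)] subsetD[OF hV] by (simp add: restr_def)
    qed (use XY in \<open>simp_all add: restr_def\<close>)
    then show ?thesis by simp
  qed
qed

end

theory Submission
  imports Defs
begin

text \<open>
  The maps in the centroid of the algebra \<open>(\<gg>, \<nabla>)\<close>, i.e. the linear \<open>f\<close> with
  \<open>f (\<nabla>\<^bsub>X\<^esub> Y) = \<nabla>\<^bsub>f X\<^esub> Y = \<nabla>\<^bsub>X\<^esub> (f Y)\<close>, commute and are self-adjoint on
  \<open>D = \<nabla>\<^bsub>\<gg>\<^esub> \<gg>\<close>. Since \<open>\<nabla>\<^bsub>X\<^esub>\<close> is skew, \<open>Ann\<^sub>R\<close> is the orthogonal complement of \<open>D\<close>,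
  so total isotropy says \<open>Ann\<^sub>R \<subseteq> D\<close>. It follows that the image of an idempotent centroid map is a
  non-degenerate strong ideal, and that a centroid map that is idempotent on \<open>D\<close> can be lifted to
  an idempotent centroid map. Projections of decompositions into strong ideals lie in the centroid.
  For a projection \<open>p\<close> onto an indecomposable factor and a projection \<open>q\<close> of the other
  decomposition, lifting \<open>p \<circ> q \<circ> p\<close> shows that on \<open>D\<close> either \<open>q \<circ> p = 0\<close> or \<open>q \<circ> p = p\<close>. Hence the
  two families of projections agree on \<open>D\<close> up to a permutation, while off \<open>D\<close> matching projections
  differ only by elements of \<open>Ann\<^sub>R\<close>.
\<close>

section \<open>Centroid maps and linear maps on a subspace\<close>

text \<open>The maps are total functions with arbitrary values off the carrier, so members are
  always compared pointwise, on all of \<open>V\<close> or only on \<open>D\<close>.\<close>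

definition centroid :: "'a::real_vector mla \<Rightarrow> ('a \<Rightarrow> 'a) set" where
  "centroid M = {f. linear_between (space_of M) (space_of M) f \<and>
     (\<forall>X\<in>space_of M. \<forall>Y\<in>space_of M.
        f (nabla M X Y) = nabla M (f X) Y \<and> f (nabla M X Y) = nabla M X (f Y))}"

lemma linear_between_in: "linear_between V W f \<Longrightarrow> x \<in> V \<Longrightarrow> f x \<in> W"
  by (auto simp: linear_between_def)

lemma linear_between_add:
  "linear_between V W f \<Longrightarrow> x \<in> V \<Longrightarrow> y \<in> V \<Longrightarrow> f (x + y) = f x + f y"
  by (auto simp: linear_between_def)

lemma linear_between_scale: "linear_between V W f \<Longrightarrow> x \<in> V \<Longrightarrow> f (c *\<^sub>R x) = c *\<^sub>R f x"
  by (auto simp: linear_between_def)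

lemma linear_between_diff:
  assumes "linear_between V W f" "subspace V" "x \<in> V" "y \<in> V"
  shows "f (x - y) = f x - f y"
  using linear_between_add[OF assms(1), of "x - y" y] assms by (simp add: subspace_diff)

lemma linear_between_0: "linear_between V W f \<Longrightarrow> subspace V \<Longrightarrow> f 0 = 0"
  using linear_between_diff[of V W f 0 0] by (simp add: subspace_0)

lemma linear_between_sum:
  assumes f: "linear_between V W f" and V: "subspace V" and "\<And>i. i \<in> I \<Longrightarrow> x i \<in> V"
  shows "f (\<Sum>i\<in>I. x i) = (\<Sum>i\<in>I. f (x i))"
  using assms(3)
proof (induction I rule: infinite_finite_induct)
  case (insert i I)
  then show ?case
    using linear_between_add[OF f, of "x i" "\<Sum>i\<in>I. x i"] subspace_sum[OF V, of I x] by simp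
qed (use linear_between_0[OF f V] in auto)

lemma linear_between_eq_on_span:
  assumes f: "linear_between V W f" and g: "linear_between V W g" and V: "subspace V"
    and "B \<subseteq> V" and "\<And>b. b \<in> B \<Longrightarrow> f b = g b" and "x \<in> span B"
  shows "f x = g x"
proof -
  have "subspace {x\<in>V. f x = g x}"
    using linear_between_0[OF f V] linear_between_0[OF g V] subspace_0[OF V]
    by (auto simp: subspace_def subspace_add[OF V] subspace_scale[OF V] linear_between_add[OF f]
        linear_between_add[OF g] linear_between_scale[OF f] linear_between_scale[OF g])
  then have "span B \<subseteq> {x\<in>V. f x = g x}"
    by (rule span_minimal[rotated]) (use assms in auto)
  then show ?thesis using assms by auto
qed

section \<open>Components of a direct sum of subspaces\<close>

context
  fixes I :: "'i set" and V :: "'a::real_vector set" and G :: "'i \<Rightarrow> 'a set"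
  assumes I: "finite I" and ds: "is_direct_sum V I G"
begin

lemma direct_sum_subspace: "i \<in> I \<Longrightarrow> subspace (G i)"
  using ds by (auto simp: is_direct_sum_def)

lemma direct_sum_in: "(\<And>i. i \<in> I \<Longrightarrow> x i \<in> G i) \<Longrightarrow> (\<Sum>i\<in>I. x i) \<in> V"
  using ds by (auto simp: is_direct_sum_def sum_subspaces_def)

lemma direct_sum_component_sub: "i \<in> I \<Longrightarrow> G i \<subseteq> V"
proof
  fix x assume i: "i \<in> I" and x: "x \<in> G i"
  have "(\<Sum>k\<in>I. if k = i then x else 0) \<in> V"
    by (rule direct_sum_in) (use x direct_sum_subspace subspace_0 in auto)
  then show "x \<in> V" using I i by simp
qed

text \<open>Replaces the definite description behind \<open>component\<close> by a rule for
  computing: later arguments exhibit a family and read off its entries. Uniqueness of the described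
  vector is directness of the sum.\<close>

lemma component_sum:
  assumes x: "\<And>i. i \<in> I \<Longrightarrow> x i \<in> G i" and i: "i \<in> I"
  shows "component I G i (\<Sum>i\<in>I. x i) = x i"
  unfolding component_def proj_along_def
proof (rule the_equality)
  have *: "(\<Sum>i\<in>I. x i) - x i = (\<Sum>i\<in>I - {i}. x i)"
    using I i by (simp add: sum.remove)
  then show "x i \<in> G i \<and> (\<Sum>i\<in>I. x i) - x i \<in> sum_subspaces (I - {i}) G"
    using x i by (auto simp: sum_subspaces_def)
  fix y assume y: "y \<in> G i \<and> (\<Sum>i\<in>I. x i) - y \<in> sum_subspaces (I - {i}) G"
  then obtain z where z: "\<forall>k\<in>I - {i}. z k \<in> G k" "(\<Sum>i\<in>I. x i) - y = (\<Sum>k\<in>I - {i}. z k)"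
    by (auto simp: sum_subspaces_def)
  \<comment> \<open>The difference of two representations of the same vector, the second with entry
    \<open>y\<close> at \<open>i\<close> and \<open>z\<close> elsewhere.\<close>
  define w where "w k = (if k = i then x i - y else x k - z k)" for k
  have "\<forall>k\<in>I. w k \<in> G k"
    using x y z i direct_sum_subspace by (auto simp: w_def subspace_diff)
  moreover have "(\<Sum>k\<in>I. w k) = 0"
  proof -
    have "(\<Sum>k\<in>I. w k) = w i + (\<Sum>k\<in>I - {i}. w k)" using I i by (rule sum.remove)
    also have "(\<Sum>k\<in>I - {i}. w k) = (\<Sum>k\<in>I - {i}. x k - z k)"
      by (rule sum.cong) (auto simp: w_def)
    finally show ?thesis using * z(2) by (simp add: w_def sum_subtractf algebra_simps)
  qed
  ultimately have "w i = 0" using ds i by (auto simp: is_direct_sum_def)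
  then show "y = x i" by (simp add: w_def)
qed

lemma direct_sum_decompose:
  assumes "v \<in> V"
  shows "i \<in> I \<Longrightarrow> component I G i v \<in> G i" and "(\<Sum>i\<in>I. component I G i v) = v"
proof -
  obtain x where x: "\<forall>i\<in>I. x i \<in> G i" "v = (\<Sum>i\<in>I. x i)"
    using assms ds by (auto simp: is_direct_sum_def sum_subspaces_def)
  then show "i \<in> I \<Longrightarrow> component I G i v \<in> G i" using component_sum[of x i] by auto
  have "(\<Sum>i\<in>I. component I G i v) = (\<Sum>i\<in>I. x i)"
    by (rule sum.cong) (use x component_sum[of x] in auto)
  then show "(\<Sum>i\<in>I. component I G i v) = v" using x by simp
qed

lemma component_component:
  assumes i: "i \<in> I" and k: "k \<in> I" and v: "v \<in> G k"
  shows "component I G i v = (if i = k then v else 0)"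
proof -
  have "component I G i (\<Sum>j\<in>I. if j = k then v else 0) = (if i = k then v else 0)"
    by (rule component_sum) (use i v direct_sum_subspace subspace_0 in auto)
  then show ?thesis using I k by simp
qed

lemma component_linear: "i \<in> I \<Longrightarrow> linear_between V V (component I G i)"
  unfolding linear_between_def
proof (intro conjI ballI allI)
  assume i: "i \<in> I"
  show "component I G i ` V \<subseteq> V"
    using direct_sum_decompose(1) direct_sum_component_sub i by blast
  fix x assume x: "x \<in> V"
  { fix y assume y: "y \<in> V"
    \<comment> \<open>Additivity is read off from the entrywise sum of the two component families,
      which represents \<open>x + y\<close>.\<close>
    have "component I G i (\<Sum>i\<in>I. component I G i x + component I G i y)
        = component I G i x + component I G i y"
      by (rule component_sum)
        (use i x y direct_sum_decompose(1) direct_sum_subspace subspace_add in blast)+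
    then show "component I G i (x + y) = component I G i x + component I G i y"
      using direct_sum_decompose(2) x y by (simp add: sum.distrib) }
  fix c
  have "component I G i (\<Sum>i\<in>I. c *\<^sub>R component I G i x) = c *\<^sub>R component I G i x"
    by (rule component_sum)
      (use i x direct_sum_decompose(1) direct_sum_subspace subspace_scale in blast)+
  then show "component I G i (c *\<^sub>R x) = c *\<^sub>R component I G i x"
    using direct_sum_decompose(2)[OF x] by (simp flip: scaleR_sum_right)
qed

end

section \<open>The Levi-Civita product of a metric Lie algebra\<close>

locale metric_lie =
  fixes M :: "'a::real_vector mla"
  assumes M: "metric_lie_algebra M"
begin

abbreviation "V \<equiv> space_of M"
abbreviation "nab \<equiv> nabla M"
abbreviation "D \<equiv> nabla_span M V V"

lemmas F = mla_facts[OF M]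

lemma form_linear: "X \<in> V \<Longrightarrow> linear_between V UNIV (\<lambda>Y. form M X Y)"
  using M by (auto simp: metric_lie_algebra_def)

lemma form_linear_left: "Y \<in> V \<Longrightarrow> linear_between V UNIV (\<lambda>X. form M X Y)"
  using M by (auto simp: metric_lie_algebra_def)

lemma form_eqI:
  assumes "X \<in> V" "Y \<in> V" "\<And>Z. Z \<in> V \<Longrightarrow> form M X Z = form M Y Z"
  shows "X = Y"
proof -
  have "X - Y \<in> V" using assms F(1) subspace_diff by blast
  moreover have "form M (X - Y) Z = 0" if "Z \<in> V" for Z
    using assms that linear_between_diff[OF form_linear_left F(1)] by simp
  ultimately show ?thesis
    using M unfolding metric_lie_algebra_def nondegenerate_on_def by fastforce
qed

lemma koszul:
  assumes "X \<in> V" "Y \<in> V" "Z \<in> V"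
  shows "2 * form M (nab X Y) Z =
     form M (bracket M X Y) Z - form M (bracket M Y Z) X + form M (bracket M Z X) Y"
  using nabla_iff[OF M assms(1,2)] assms(3) by blast

lemma nabla_in: "X \<in> V \<Longrightarrow> Y \<in> V \<Longrightarrow> nab X Y \<in> V"
  using nabla_iff[OF M] by blast

text \<open>Metric compatibility: adding the Koszul formulas for \<open>X, Y, Z\<close> and
  \<open>X, Z, Y\<close>, all terms cancel by antisymmetry of the bracket.\<close>

lemma nabla_skew:
  assumes "X \<in> V" "Y \<in> V" "Z \<in> V"
  shows "form M (nab X Y) Z = - form M Y (nab X Z)"
proof -
  have neg: "form M (bracket M P Q) R = - form M (bracket M Q P) R"
    if "P \<in> V" "Q \<in> V" "R \<in> V" for P Q R
    using F(10)[OF that(1,2)] F(8)[of "bracket M Q P" R "-1"] F(2) that by simp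
  have "2 * form M (nab X Y) Z = - (2 * form M (nab X Z) Y)"
    using koszul[OF assms] koszul[OF assms(1,3,2)] neg[OF assms] neg[OF assms(1,3,2)]
      neg[OF assms(2,3,1)] by linarith
  then show ?thesis using F(9)[OF nabla_in[OF assms(1,3)] assms(2)] by simp
qed

text \<open>Skewness carries the second factor out of the product, where linearity of the form
  applies.\<close>

lemma nabla_linear:
  assumes "X \<in> V"
  shows "linear_between V V (nab X)"
proof -
  have "nab X (Y + Y') = nab X Y + nab X Y'" if Y: "Y \<in> V" "Y' \<in> V" for Y Y'
  proof (rule form_eqI)
    fix Z assume Z: "Z \<in> V"
    have "form M (nab X Y + nab X Y') Z = form M (nab X Y) Z + form M (nab X Y') Z"
      by (rule F(7)) (use assms Y Z nabla_in in auto)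
    then show "form M (nab X (Y + Y')) Z = form M (nab X Y + nab X Y') Z"
      using assms Y Z nabla_skew F(7) nabla_in subspace_add[OF F(1)] by simp
  qed (use assms Y nabla_in subspace_add[OF F(1)] in auto)
  moreover have "nab X (c *\<^sub>R Y) = c *\<^sub>R nab X Y" if Y: "Y \<in> V" for c Y
  proof (rule form_eqI)
    fix Z assume Z: "Z \<in> V"
    have "form M (c *\<^sub>R nab X Y) Z = c * form M (nab X Y) Z"
      by (rule F(8)) (use assms Y Z nabla_in in auto)
    then show "form M (nab X (c *\<^sub>R Y)) Z = form M (c *\<^sub>R nab X Y) Z"
      using assms Y Z nabla_skew F(8) nabla_in subspace_scale[OF F(1)] by simp
  qed (use assms Y nabla_in subspace_scale[OF F(1)] in auto)
  ultimately show ?thesis using assms nabla_in by (auto simp: linear_between_def)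
qed

text \<open>Skewness leaves the first factor inside the product, so linearity in it is taken from
  the Koszul formula.\<close>

lemma nabla_linear_left:
  assumes "Y \<in> V"
  shows "linear_between V V (\<lambda>X. nab X Y)"
proof -
  note fl = linear_between_add[OF form_linear] linear_between_scale[OF form_linear]
  have "nab (X + X') Y = nab X Y + nab X' Y" if X: "X \<in> V" "X' \<in> V" for X X'
  proof (rule form_eqI)
    fix Z assume Z: "Z \<in> V"
    have "form M (nab X Y + nab X' Y) Z = form M (nab X Y) Z + form M (nab X' Y) Z"
      by (rule F(7)) (use assms X Z nabla_in in auto)
    moreover have "2 * form M (nab (X + X') Y) Z
        = 2 * form M (nab X Y) Z + 2 * form M (nab X' Y) Z"
      using assms X Z koszul F(2-7) fl subspace_add[OF F(1)] by simp
    ultimately show "form M (nab (X + X') Y) Z = form M (nab X Y + nab X' Y) Z" by simp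
  qed (use assms X nabla_in subspace_add[OF F(1)] in auto)
  moreover have "nab (c *\<^sub>R X) Y = c *\<^sub>R nab X Y" if X: "X \<in> V" for c X
  proof (rule form_eqI)
    fix Z assume Z: "Z \<in> V"
    have "form M (c *\<^sub>R nab X Y) Z = c * form M (nab X Y) Z"
      by (rule F(8)) (use assms X Z nabla_in in auto)
    moreover have "form M (bracket M (c *\<^sub>R X) Y) Z = c * form M (bracket M X Y) Z"
      "form M (bracket M Y Z) (c *\<^sub>R X) = c * form M (bracket M Y Z) X"
      "form M (bracket M Z (c *\<^sub>R X)) Y = c * form M (bracket M Z X) Y"
      using assms X Z F(2-8) fl by simp_all
    then have "2 * form M (nab (c *\<^sub>R X) Y) Z = c * (2 * form M (nab X Y) Z)"
      unfolding koszul[OF X assms Z] koszul[OF subspace_scale[OF F(1) X] assms Z]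
      by (simp add: distrib_left right_diff_distrib)
    ultimately show "form M (nab (c *\<^sub>R X) Y) Z = form M (c *\<^sub>R nab X Y) Z" by simp
  qed (use assms X nabla_in subspace_scale[OF F(1)] in auto)
  ultimately show ?thesis using assms nabla_in by (auto simp: linear_between_def)
qed

lemma nabla_in_D: "X \<in> V \<Longrightarrow> Y \<in> V \<Longrightarrow> nab X Y \<in> D"
  by (auto simp: nabla_span_def intro!: span_base)

lemma D_sub: "D \<subseteq> V"
  unfolding nabla_span_def by (rule span_minimal) (use nabla_in F(1) in auto)

text \<open>The principle by which identities are proved on \<open>D\<close>: it is spanned by
  products, so linear maps need only be compared there.\<close>

lemma nabla_eq_on_D:
  assumes "linear_between V W f" "linear_between V W g"
    and "\<And>X Y. X \<in> V \<Longrightarrow> Y \<in> V \<Longrightarrow> f (nab X Y) = g (nab X Y)" and "x \<in> D"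
  shows "f x = g x"
  by (rule linear_between_eq_on_span[OF assms(1,2) F(1)])
    (use assms(3,4) nabla_in in \<open>auto simp: nabla_span_def\<close>)

section \<open>Closure properties of the centroid and its action on \<open>D\<close>\<close>

lemma centroid_linear: "f \<in> centroid M \<Longrightarrow> linear_between V V f"
  by (simp add: centroid_def)

lemmas centroid_in = linear_between_in[OF centroid_linear]
lemmas centroid_add = linear_between_add[OF centroid_linear]
lemmas centroid_scale = linear_between_scale[OF centroid_linear]
lemmas centroid_diff = linear_between_diff[OF centroid_linear F(1)]

lemma centroid_left: "f \<in> centroid M \<Longrightarrow> X \<in> V \<Longrightarrow> Y \<in> V \<Longrightarrow> f (nab X Y) = nab (f X) Y"
  by (simp add: centroid_def)

lemma centroid_right: "f \<in> centroid M \<Longrightarrow> X \<in> V \<Longrightarrow> Y \<in> V \<Longrightarrow> f (nab X Y) = nab X (f Y)"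
  unfolding centroid_def by blast

lemma centroidI:
  assumes "\<And>x. x \<in> V \<Longrightarrow> f x \<in> V"
    and "\<And>x y. x \<in> V \<Longrightarrow> y \<in> V \<Longrightarrow> f (x + y) = f x + f y"
    and "\<And>c x. x \<in> V \<Longrightarrow> f (c *\<^sub>R x) = c *\<^sub>R f x"
    and "\<And>X Y. X \<in> V \<Longrightarrow> Y \<in> V \<Longrightarrow> f (nab X Y) = nab (f X) Y"
    and "\<And>X Y. X \<in> V \<Longrightarrow> Y \<in> V \<Longrightarrow> f (nab X Y) = nab X (f Y)"
  shows "f \<in> centroid M"
  unfolding centroid_def linear_between_def using assms by blast

lemma centroid_comp: "f \<in> centroid M \<Longrightarrow> g \<in> centroid M \<Longrightarrow> (\<lambda>x. f (g x)) \<in> centroid M"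
  by (rule centroidI)
    (metis centroid_in centroid_add centroid_scale centroid_left centroid_right)+

lemma centroid_scaleR:
  assumes f: "f \<in> centroid M"
  shows "(\<lambda>x. c *\<^sub>R f x) \<in> centroid M"
proof (rule centroidI)
  show "c *\<^sub>R f (nab X Y) = nab (c *\<^sub>R f X) Y" if "X \<in> V" "Y \<in> V" for X Y
    using that by (simp add: centroid_left[OF f] centroid_in[OF f]
        linear_between_scale[OF nabla_linear_left])
  show "c *\<^sub>R f (nab X Y) = nab X (c *\<^sub>R f Y)" if "X \<in> V" "Y \<in> V" for X Y
    using that by (simp add: centroid_right[OF f] centroid_in[OF f]
        linear_between_scale[OF nabla_linear])
qed (use centroid_in[OF f] subspace_scale[OF F(1)] in
      \<open>auto simp: centroid_add[OF f] centroid_scale[OF f] scaleR_right_distrib mult.commute\<close>)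

lemma centroid_sum:
  assumes f: "\<And>i. i \<in> I \<Longrightarrow> f i \<in> centroid M"
  shows "(\<lambda>x. \<Sum>i\<in>I. f i x) \<in> centroid M"
proof (rule centroidI)
  note fin = centroid_in[OF f]
  show "(\<Sum>i\<in>I. f i x) \<in> V" if "x \<in> V" for x
    by (rule subspace_sum[OF F(1)]) (use that fin in blast)
  show "(\<Sum>i\<in>I. f i (x + y)) = (\<Sum>i\<in>I. f i x) + (\<Sum>i\<in>I. f i y)"
    if "x \<in> V" "y \<in> V" for x y
    unfolding sum.distrib[symmetric] by (rule sum.cong) (use that centroid_add[OF f] in auto)
  show "(\<Sum>i\<in>I. f i (c *\<^sub>R x)) = c *\<^sub>R (\<Sum>i\<in>I. f i x)" if "x \<in> V" for x c
    unfolding scaleR_sum_right by (rule sum.cong) (use that centroid_scale[OF f] in auto)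
  fix X Y assume XY: "X \<in> V" "Y \<in> V"
  have "nab (\<Sum>i\<in>I. f i X) Y = (\<Sum>i\<in>I. nab (f i X) Y)"
    by (rule linear_between_sum[OF nabla_linear_left F(1)]) (use XY fin in auto)
  also have "\<dots> = (\<Sum>i\<in>I. f i (nab X Y))"
    by (rule sum.cong) (use XY centroid_left[OF f] in auto)
  finally show "(\<Sum>i\<in>I. f i (nab X Y)) = nab (\<Sum>i\<in>I. f i X) Y" by simp
  have "nab X (\<Sum>i\<in>I. f i Y) = (\<Sum>i\<in>I. nab X (f i Y))"
    by (rule linear_between_sum[OF nabla_linear F(1)]) (use XY fin in auto)
  also have "\<dots> = (\<Sum>i\<in>I. f i (nab X Y))"
    by (rule sum.cong) (use XY centroid_right[OF f] in auto)
  finally show "(\<Sum>i\<in>I. f i (nab X Y)) = nab X (\<Sum>i\<in>I. f i Y)" by simp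
qed

lemma centroid_minus:
  assumes f: "f \<in> centroid M" and g: "g \<in> centroid M"
  shows "(\<lambda>x. f x - g x) \<in> centroid M"
proof -
  \<comment> \<open>The difference is written as a two-term sum indexed by \<open>bool\<close>, so
    closure under sums and scalars suffices.\<close>
  have "(\<lambda>x. \<Sum>i\<in>(UNIV :: bool set). (if i then f x else (-1) *\<^sub>R g x)) \<in> centroid M"
  proof (rule centroid_sum)
    fix i :: bool
    show "(\<lambda>x. if i then f x else (-1) *\<^sub>R g x) \<in> centroid M"
      using f centroid_scaleR[OF g, of "-1"] by (cases i) simp_all
  qed
  then show ?thesis by (simp add: UNIV_bool)
qed

lemma centroid_eq_on_D:
  assumes "f \<in> centroid M" "g \<in> centroid M"
    and "\<And>X Y. X \<in> V \<Longrightarrow> Y \<in> V \<Longrightarrow> f (nab X Y) = g (nab X Y)" and "x \<in> D"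
  shows "f x = g x"
  by (rule nabla_eq_on_D[OF centroid_linear centroid_linear]) (use assms in auto)

text \<open>On a product one map can act on the left factor and the other on the right one, so their
  order is immaterial. The argument needs a product to act on, hence the restriction to
  \<open>D\<close>.\<close>

lemma centroid_commute_on_D:
  assumes f: "f \<in> centroid M" and g: "g \<in> centroid M" and "x \<in> D"
  shows "f (g x) = g (f x)"
proof (rule centroid_eq_on_D[OF centroid_comp[OF f g] centroid_comp[OF g f] _ assms(3)])
  fix X Y assume "X \<in> V" "Y \<in> V"
  then show "f (g (nab X Y)) = g (f (nab X Y))"
    using centroid_left[OF f] centroid_right[OF g] centroid_in[OF f] centroid_in[OF g] by metis
qed

lemma centroid_D:
  assumes f: "f \<in> centroid M" and "x \<in> D"
  shows "f x \<in> D"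
proof -
  have "subspace {x \<in> V. f x \<in> D}"
    using linear_between_0[OF centroid_linear[OF f] F(1)] subspace_0[OF F(1)]
    by (auto simp: subspace_def subspace_add[OF F(1)] subspace_scale[OF F(1)] centroid_add[OF f]
        centroid_scale[OF f] nabla_span_def span_add span_scale span_zero)
  then have "D \<subseteq> {x \<in> V. f x \<in> D}"
    by (subst nabla_span_def, intro span_minimal)
      (use nabla_in nabla_in_D centroid_left[OF f] centroid_in[OF f] in auto)
  then show ?thesis using assms by auto
qed

text \<open>On \<open>x = nab A B\<close>: attach \<open>f\<close> to \<open>A\<close>, move the
  product to the other side by skewness, pass \<open>f\<close> from \<open>A\<close> to
  \<open>Y\<close>, and move the product back.\<close>

lemma centroid_self_adjoint:
  assumes f: "f \<in> centroid M" and "x \<in> D" and Y: "Y \<in> V"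
  shows "form M (f x) Y = form M x (f Y)"
proof (rule nabla_eq_on_D[OF _ _ _ assms(2)])
  show "linear_between V UNIV (\<lambda>x. form M (f x) Y)"
    using form_linear_left[OF Y] centroid_linear[OF f]
    unfolding linear_between_def image_subset_iff by simp
  show "linear_between V UNIV (\<lambda>x. form M x (f Y))"
    by (rule form_linear_left[OF centroid_in[OF f Y]])
  fix A B assume AB: "A \<in> V" "B \<in> V"
  have "form M (f (nab A B)) Y = form M (nab (f A) B) Y"
    using AB by (simp add: centroid_left[OF f])
  also have "\<dots> = - form M B (nab (f A) Y)"
    using AB Y by (intro nabla_skew centroid_in[OF f])
  also have "nab (f A) Y = nab A (f Y)"
    using AB Y by (simp flip: centroid_left[OF f] centroid_right[OF f])
  also have "- form M B (nab A (f Y)) = form M (nab A B) (f Y)"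
    using AB Y by (simp add: nabla_skew centroid_in[OF f])
  finally show "form M (f (nab A B)) Y = form M (nab A B) (f Y)" .
qed

section \<open>The right annihilator and strong ideals\<close>

lemma Ann_R_sub: "Ann_R M \<subseteq> V"
  by (auto simp: Ann_R_def)

text \<open>By skewness, pairing \<open>nab X u\<close> with \<open>Z\<close> is, up to sign,
  pairing \<open>u\<close> with the product \<open>nab X Z\<close>.\<close>

lemma Ann_R_orthogonal:
  assumes u: "u \<in> V" and "\<And>X Y. X \<in> V \<Longrightarrow> Y \<in> V \<Longrightarrow> form M u (nab X Y) = 0"
  shows "u \<in> Ann_R M"
proof -
  have "nab X u = 0" if X: "X \<in> V" for X
  proof (rule form_eqI)
    fix Z assume "Z \<in> V"
    then show "form M (nab X u) Z = form M 0 Z"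
      using assms X by (simp add: nabla_skew linear_between_0[OF form_linear_left F(1)])
  qed (use X u nabla_in subspace_0[OF F(1)] in auto)
  then show ?thesis using u by (auto simp: Ann_R_def)
qed

text \<open>A product with right factor \<open>f x\<close> is the value of \<open>f\<close> at a
  product, hence at an element of \<open>D\<close>.\<close>

lemma Ann_R_centroid:
  assumes f: "f \<in> centroid M" and "\<And>x. x \<in> D \<Longrightarrow> f x = 0" and "x \<in> V"
  shows "f x \<in> Ann_R M"
  using assms centroid_in[OF f] nabla_in_D by (auto simp: Ann_R_def simp flip: centroid_right[OF f])

text \<open>Both maps can be pulled out of the product. Spans of products of factors thus depend
  only on what the projections do on \<open>D\<close>.\<close>

lemma nabla_span_image:
  assumes f: "f \<in> centroid M" and g: "g \<in> centroid M"
  shows "nabla_span M (f ` V) (g ` V) = span {f (g (nab X Y)) | X Y. X \<in> V \<and> Y \<in> V}"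
proof -
  have "{nab X Y |X Y. X \<in> f ` V \<and> Y \<in> g ` V} = {nab (f X) (g Y) |X Y. X \<in> V \<and> Y \<in> V}"
    by blast
  also have "\<dots> = {f (g (nab X Y)) | X Y. X \<in> V \<and> Y \<in> V}"
  proof -
    have "nab (f X) (g Y) = f (g (nab X Y))" if "X \<in> V" "Y \<in> V" for X Y
      using that by (simp add: centroid_left[OF f] centroid_right[OF g] centroid_in[OF g])
    then show ?thesis by force
  qed
  finally show ?thesis by (simp add: nabla_span_def)
qed

lemma strong_ideal_image:
  assumes f: "f \<in> centroid M"
  shows "strong_ideal M (f ` V)"
proof -
  have s: "subspace (f ` V)"
  proof (rule subspaceI)
    show "0 \<in> f ` V"
      using linear_between_0[OF centroid_linear[OF f] F(1)] subspace_0[OF F(1)] by (metis imageI)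
    show "x + y \<in> f ` V" if "x \<in> f ` V" "y \<in> f ` V" for x y
      using that subspace_add[OF F(1)] by (auto simp flip: centroid_add[OF f])
    show "c *\<^sub>R x \<in> f ` V" if "x \<in> f ` V" for x c
      using that subspace_scale[OF F(1)] by (auto simp flip: centroid_scale[OF f])
  qed
  show ?thesis
    unfolding strong_ideal_def nabla_span_def
  proof (intro conjI s span_minimal[OF _ s])
    show "f ` V \<subseteq> V" using centroid_in[OF f] by blast
    show "{nab X Y |X Y. X \<in> V \<and> Y \<in> f ` V} \<subseteq> f ` V"
      using nabla_in by (auto simp flip: centroid_right[OF f])
    show "{nab X Y |X Y. X \<in> f ` V \<and> Y \<in> V} \<subseteq> f ` V"
      using nabla_in by (auto simp flip: centroid_left[OF f])
  qed
qed

lemma strong_ideal_nabla: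
  assumes "strong_ideal M h" "X \<in> h" "Y \<in> V"
  shows "nab X Y \<in> h" and "nab Y X \<in> h"
proof -
  have "nab X Y \<in> nabla_span M h V" "nab Y X \<in> nabla_span M V h"
    using assms by (auto simp: nabla_span_def intro!: span_base)
  then show "nab X Y \<in> h" "nab Y X \<in> h" using assms by (auto simp: strong_ideal_def)
qed

text \<open>Indecomposability of a factor speaks of the restricted algebra, whereas ideals are
  constructed in \<open>M\<close>; on \<open>h\<close> the two products coincide.\<close>

lemma strong_ideal_restr:
  assumes a: "strong_ideal M a" and "a \<subseteq> h" and h: "strong_ideal M h" "nondegenerate_on M h"
  shows "strong_ideal (restr M h) a"
proof -
  have s: "subspace a" and hV: "h \<subseteq> V" using a h by (auto simp: strong_ideal_def)
  show ?thesis
    unfolding strong_ideal_def nabla_span_def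
  proof (intro conjI s span_minimal[OF _ s])
    have [simp]: "space_of (restr M h) = h" by (simp add: restr_def)
    show "a \<subseteq> space_of (restr M h)" using assms by simp
    note eq = restr_strong_ideal(2)[OF M h]
    show "{nabla (restr M h) X Y |X Y. X \<in> space_of (restr M h) \<and> Y \<in> a} \<subseteq> a"
    proof clarsimp
      fix X Y assume "X \<in> h" "Y \<in> a"
      then show "nabla (restr M h) X Y \<in> a"
        using eq[of X Y] strong_ideal_nabla(2)[OF a, of Y X] \<open>a \<subseteq> h\<close> hV by (simp add: subset_iff)
    qed
    show "{nabla (restr M h) X Y |X Y. X \<in> a \<and> Y \<in> space_of (restr M h)} \<subseteq> a"
    proof clarsimp
      fix X Y assume "X \<in> a" "Y \<in> h"
      then show "nabla (restr M h) X Y \<in> a"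
        using eq[of X Y] strong_ideal_nabla(1)[OF a, of X Y] \<open>a \<subseteq> h\<close> hV by (simp add: subset_iff)
    qed
  qed
qed

text \<open>Expand one factor of a product into components. Each resulting term lies in its own
  \<open>G k\<close> because that is a strong ideal, so the product is already decomposed and its
  \<open>i\<close>-th entry can be read off.\<close>

lemma component_centroid:
  assumes I: "finite I" and ds: "is_direct_sum V I G"
    and G: "\<And>i. i \<in> I \<Longrightarrow> strong_ideal M (G i)" and i: "i \<in> I"
  shows "component I G i \<in> centroid M"
proof -
  note dec = direct_sum_decompose[OF I ds]
  have GV: "\<And>k x. k \<in> I \<Longrightarrow> x \<in> G k \<Longrightarrow> x \<in> V" using direct_sum_component_sub[OF I ds] by blast
  have "component I G i (nab X Y) = nab (component I G i X) Y" if XY: "X \<in> V" "Y \<in> V" for X Y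
  proof -
    have "nab X Y = nab (\<Sum>k\<in>I. component I G k X) Y" using dec(2)[OF XY(1)] by simp
    also have "\<dots> = (\<Sum>k\<in>I. nab (component I G k X) Y)"
      using GV dec(1) XY by (intro linear_between_sum[OF nabla_linear_left F(1)]) blast+
    finally show ?thesis
      using component_sum[OF I ds, of "\<lambda>k. nab (component I G k X) Y", OF _ i]
        strong_ideal_nabla(1)[OF G] dec(1) XY by simp
  qed
  moreover have "component I G i (nab X Y) = nab X (component I G i Y)"
    if XY: "X \<in> V" "Y \<in> V" for X Y
  proof -
    have "nab X Y = nab X (\<Sum>k\<in>I. component I G k Y)" using dec(2)[OF XY(2)] by simp
    also have "\<dots> = (\<Sum>k\<in>I. nab X (component I G k Y))"
      using GV dec(1) XY by (intro linear_between_sum[OF nabla_linear F(1)]) blast+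
    finally show ?thesis
      using component_sum[OF I ds, of "\<lambda>k. nab X (component I G k Y)", OF _ i]
        strong_ideal_nabla(2)[OF G] dec(1) XY by simp
  qed
  ultimately show ?thesis
    using component_linear[OF I ds i] by (simp add: centroid_def)
qed

end

section \<open>Idempotents of the centroid under total isotropy of the annihilator\<close>

locale isotropic_metric_lie = metric_lie +
  assumes iso: "totally_isotropic M (Ann_R M)"
begin

lemma Ann_R_sub_D: "Ann_R M \<subseteq> D"
proof
  fix v assume v: "v \<in> Ann_R M"
  show "v \<in> D"
  proof (rule ccontr)
    assume n: "v \<notin> D"
    obtain C where C: "C \<subseteq> D" "independent C" "D \<subseteq> span C"
      using maximal_independent_subset by blast
    have "subspace D" by (simp add: nabla_span_def)
    then have sC: "span C = D" using C span_minimal by blast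
    then have "independent (insert v C)" using C n independent_insertI by metis
    \<comment> \<open>A functional that vanishes on \<open>D\<close> and is 1 at \<open>v\<close>.
      Its Riesz vector \<open>u\<close> is orthogonal to \<open>D\<close>, hence lies in
      \<open>Ann_R M\<close>, and total isotropy forces \<open>p v = 0\<close>.\<close>
    from linear_independent_extend[OF this, of "\<lambda>x. if x = v then 1 else 0 :: real"]
    obtain p :: "'a \<Rightarrow> real"
      where p: "linear p" "\<forall>x\<in>insert v C. p x = (if x = v then 1 else 0)"
      by blast
    have lp: "linear_between V UNIV p"
      using p(1) by (simp add: linear_between_def linear_add linear_scale)
    have pC: "p x = 0" if "x \<in> C" for x using p(2) that n C(1) by auto
    have p0: "p x = 0" if "x \<in> D" for x
      using linear_eq_0_on_span[OF p(1) pC] that sC by blast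
    obtain u where u: "u \<in> V" "\<forall>Z\<in>V. form M u Z = p Z"
      using riesz_nondegenerate[OF M lp] by blast
    then have "u \<in> Ann_R M"
      using p0 nabla_in nabla_in_D by (intro Ann_R_orthogonal) auto
    then have "form M u v = 0" using iso v by (auto simp: totally_isotropic_def)
    then show False using u p v Ann_R_sub by auto
  qed
qed

text \<open>Self-adjointness of \<open>e\<close> is used twice. First its \<open>D\<close>-argument
  is a product, which shows that \<open>X\<close> is orthogonal to \<open>D\<close> and so lies in
  \<open>Ann_R M\<close>, hence in \<open>D\<close>. Then \<open>X\<close> itself is the
  \<open>D\<close>-argument, and every pairing of \<open>X\<close> reduces to one within the
  image.\<close>

lemma nondegenerate_image:
  assumes e: "e \<in> centroid M" and idem: "\<And>x. x \<in> V \<Longrightarrow> e (e x) = e x"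
  shows "nondegenerate_on M (e ` V)"
  unfolding nondegenerate_on_def
proof (intro ballI impI)
  fix X assume X: "X \<in> e ` V" and 0: "\<forall>Y\<in>e ` V. form M X Y = 0"
  have eX: "e X = X" and XV: "X \<in> V" using X idem centroid_in[OF e] by auto
  have "form M X (nab A B) = 0" if "A \<in> V" "B \<in> V" for A B
  proof -
    have "form M X (nab A B) = form M (nab A B) (e X)" using that XV F(9) nabla_in eX by simp
    also have "\<dots> = form M (e (nab A B)) X"
      using centroid_self_adjoint[OF e _ XV] nabla_in_D that by simp
    also have "\<dots> = 0" using 0 nabla_in that F(9) XV centroid_in[OF e] by force
    finally show ?thesis .
  qed
  then have "X \<in> D" using Ann_R_orthogonal[OF XV] Ann_R_sub_D by blast
  then have "form M X Y = form M X (e Y)" if "Y \<in> V" for Y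
    using centroid_self_adjoint[OF e _ that] eX by metis
  then have "form M X Y = 0" if "Y \<in> V" for Y using 0 that by auto
  then show "X = 0"
    using form_eqI[OF XV subspace_0[OF F(1)]] linear_between_0[OF form_linear_left F(1)] by simp
qed

text \<open>If \<open>p\<close> killed \<open>D\<close>, its values would lie in
  \<open>Ann_R M\<close>, hence in \<open>D\<close>, and applying \<open>p\<close> once more would
  give zero.\<close>

lemma idempotent_nonzero_on_D:
  assumes p: "p \<in> centroid M" "\<And>x. x \<in> V \<Longrightarrow> p (p x) = p x" and "p ` V \<noteq> {0}"
  shows "\<exists>x\<in>D. p x \<noteq> 0"
proof (rule ccontr)
  assume n: "\<not> ?thesis"
  then have D0: "p x = 0" if "x \<in> D" for x using that by blast
  then have "p x = 0" if "x \<in> V" for x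
    using Ann_R_centroid[OF p(1) D0 that] Ann_R_sub_D D0 p(2)[OF that] by auto
  then have "p ` V = {0}" using subspace_0[OF F(1)] by (auto simp: image_iff)
  then show False using assms(3) by simp
qed

text \<open>The defect \<open>f\<^sup>2 - f\<close> kills \<open>D\<close>, hence maps into \<open>Ann\<^sub>R \<subseteq> D\<close> and squares to zero, so the usual
  lift \<open>3 f\<^sup>2 - 2 f\<^sup>3\<close> is idempotent.\<close>

lemma idempotent_lift:
  assumes f: "f \<in> centroid M" and fD: "\<And>x. x \<in> D \<Longrightarrow> f (f x) = f x"
  defines "e \<equiv> \<lambda>x. 3 *\<^sub>R f (f x) - 2 *\<^sub>R f (f (f x))"
  shows "e \<in> centroid M" and "\<And>x. x \<in> V \<Longrightarrow> e (e x) = e x" and "\<And>x. x \<in> D \<Longrightarrow> e x = f x"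
proof -
  note ff = centroid_comp[OF f f] and fff = centroid_comp[OF f centroid_comp[OF f f]]
  show "e \<in> centroid M"
    unfolding e_def by (intro centroid_minus centroid_scaleR ff fff)
  show "e x = f x" if "x \<in> D" for x
    using fD that by (simp add: e_def flip: scaleR_left_diff_distrib)
  have rel: "f (f (f (f x))) = 2 *\<^sub>R f (f (f x)) - f (f x)" if x: "x \<in> V" for x
  proof -
    let ?n = "\<lambda>x. f (f x) - f x"
    have n: "?n \<in> centroid M" by (intro centroid_minus ff f)
    have "?n x \<in> D" using Ann_R_centroid[OF n _ x] fD Ann_R_sub_D by auto
    then have "?n (?n x) = 0" using fD by simp
    then show ?thesis
      using x by (simp add: centroid_diff[OF f] centroid_in[OF f] algebra_simps scaleR_2)
  qed
  fix x assume x: "x \<in> V"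
  define y where "y = f (f x)"
  define z where "z = f (f (f x))"
  have yz: "y \<in> V" "z \<in> V" using x centroid_in[OF f] by (auto simp: y_def z_def)
  have fy: "f y = z" by (simp add: y_def z_def)
  have fz: "f z = 2 *\<^sub>R z - 1 *\<^sub>R y" using rel[OF x] by (simp add: y_def z_def)
  have ex: "e x = 3 *\<^sub>R y - 2 *\<^sub>R z" by (simp add: e_def y_def z_def)
  \<comment> \<open>The span of \<open>y\<close> and \<open>z\<close> is stable under
    \<open>f\<close>, so only coefficients need tracking: \<open>(a, b)\<close> becomes
    \<open>(b, 2 * b - a)\<close>. From \<open>e x\<close> the pairs run (3,2), (2,1), (1,0),
    (0,-1); the trivial scalars below keep this shape.\<close>
  have lin: "f (a *\<^sub>R y - b *\<^sub>R z) = b *\<^sub>R y - (2 * b - a) *\<^sub>R z" for a b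
    using yz by (simp add: centroid_diff[OF f] centroid_scale[OF f] subspace_scale[OF F(1)]
        fy fz algebra_simps)
  have f1: "f (e x) = 2 *\<^sub>R y - 1 *\<^sub>R z" unfolding ex lin by simp
  have f2: "f (f (e x)) = 1 *\<^sub>R y - 0 *\<^sub>R z" unfolding f1 lin by simp
  have f3: "f (f (f (e x))) = 0 *\<^sub>R y - (-1) *\<^sub>R z" unfolding f2 lin by simp
  show "e (e x) = e x"
    by (subst e_def, subst f3, subst f2) (simp add: ex)
qed

text \<open>The idempotent lift \<open>e\<close> of \<open>p (q (p x))\<close> and its complement
  \<open>p - e\<close> split the image of \<open>p\<close> into two non-degenerate strong ideals, so
  one of them vanishes.\<close>

lemma indecomposable_dichotomy:
  assumes p: "p \<in> centroid M" "\<And>x. x \<in> V \<Longrightarrow> p (p x) = p x"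
    and q: "q \<in> centroid M" "\<And>x. x \<in> V \<Longrightarrow> q (q x) = q x"
    and ind: "indecomposable (restr M (p ` V))"
  shows "(\<forall>x\<in>D. q (p x) = 0) \<or> (\<forall>x\<in>D. q (p x) = p x)"
proof -
  \<comment> \<open>Agrees with \<open>q (p x)\<close> on \<open>D\<close>, but has \<open>p\<close>
    on both sides, so that its lift maps all of \<open>V\<close> into the image of
    \<open>p\<close>.\<close>
  define f where "f x = p (q (p x))" for x
  have f: "f \<in> centroid M"
    unfolding f_def by (rule centroid_comp[OF p(1) centroid_comp[OF q(1) p(1)]])
  have DV: "x \<in> V" if "x \<in> D" for x using that D_sub by blast
  note pD = centroid_D[OF p(1)]
  note com = centroid_commute_on_D[OF p(1) q(1)]
  have fqp: "f x = q (p x)" if "x \<in> D" for x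
    using com[OF pD[OF that]] p(2)[OF DV[OF that]] by (simp add: f_def)
  have fD: "f (f x) = f x" if x: "x \<in> D" for x
  proof -
    have "f (f x) = q (p (q (p x)))" using fqp[OF x] fqp[of "f x"] centroid_D[OF f x] by simp
    also have "\<dots> = q (q (p (p x)))" using com[OF pD[OF x]] by simp
    also have "\<dots> = f x" using fqp[OF x] p(2) q(2) DV pD x by simp
    finally show ?thesis .
  qed
  define e where "e x = 3 *\<^sub>R f (f x) - 2 *\<^sub>R f (f (f x))" for x
  have e: "e \<in> centroid M" "\<And>x. x \<in> V \<Longrightarrow> e (e x) = e x" "\<And>x. x \<in> D \<Longrightarrow> e x = f x"
    using idempotent_lift[OF f fD, folded e_def] by blast+
  have fV: "f x \<in> V" if "x \<in> V" for x using that centroid_in[OF f] by blast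
  have pf: "p (f x) = f x" "f (p x) = f x" if "x \<in> V" for x
    using that p(2) centroid_in[OF p(1)] centroid_in[OF q(1)] by (simp_all add: f_def)
  \<comment> \<open>Each term of \<open>e\<close> begins and ends with \<open>p\<close>, which is
    therefore absorbed on either side, also off \<open>D\<close>.\<close>
  have pe: "p (e x) = e x" and ep: "e (p x) = e x" if x: "x \<in> V" for x
    using x by (simp_all add: e_def pf fV centroid_diff[OF p(1)] centroid_scale[OF p(1)]
        subspace_scale[OF F(1)])
  define d where "d x = p x - e x" for x
  have d: "d \<in> centroid M" unfolding d_def by (intro centroid_minus p e)
  have pV: "p x \<in> V" and eV: "e x \<in> V" if "x \<in> V" for x
    using that centroid_in[OF p(1)] centroid_in[OF e(1)] by auto
  have dd: "d (d x) = d x" and ed: "e (d x) = 0" and pd: "p (d x) = d x" if "x \<in> V" for x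
    using that by (simp_all add: d_def centroid_diff[OF p(1)] centroid_diff[OF e(1)] pV eV pe ep
        p(2) e(2))
  note sp = strong_ideal_image[OF p(1)] nondegenerate_image[OF p(1), OF p(2)]
  have sub: "e ` V \<subseteq> p ` V" "d ` V \<subseteq> p ` V"
  proof -
    have "e x \<in> p ` V \<and> d x \<in> p ` V" if x: "x \<in> V" for x
      using imageI[of "e x" V p] pe[OF x] eV[OF x] imageI[of "d x" V p] pd[OF x]
        centroid_in[OF d x] by simp
    then show "e ` V \<subseteq> p ` V" "d ` V \<subseteq> p ` V" by blast+
  qed
  have "\<not> (e ` V \<noteq> {0} \<and> d ` V \<noteq> {0})"
  proof
    assume nz: "e ` V \<noteq> {0} \<and> d ` V \<noteq> {0}"
    have "decomposable (restr M (p ` V))"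
      unfolding decomposable_def
    proof (rule exI[of _ "e ` V"], rule exI[of _ "d ` V"], intro conjI)
      show "strong_ideal (restr M (p ` V)) (e ` V)" "strong_ideal (restr M (p ` V)) (d ` V)"
        using strong_ideal_restr[OF strong_ideal_image sub(1) sp]
          strong_ideal_restr[OF strong_ideal_image sub(2) sp] e(1) d by auto
      show "nondegenerate_on (restr M (p ` V)) (e ` V)" "nondegenerate_on (restr M (p ` V)) (d ` V)"
        using nondegenerate_image[OF e(1), OF e(2)] nondegenerate_image[OF d, OF dd]
        by (simp_all add: nondegenerate_on_def restr_def)
      show "e ` V \<noteq> {0}" "d ` V \<noteq> {0}" using nz by auto
      have "x = 0" if "x \<in> e ` V" "x \<in> d ` V" for x using that e(2) ed by (metis imageE)
      moreover have "0 \<in> e ` V" "0 \<in> d ` V"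
        using strong_ideal_image e(1) d by (auto simp: strong_ideal_def subspace_0)
      ultimately show "e ` V \<inter> d ` V = {0}" by blast
      have "p x = e x + d x" for x by (simp add: d_def)
      moreover have "e x + d y \<in> p ` V" if "x \<in> V" "y \<in> V" for x y
        using sub that sp(1) unfolding strong_ideal_def by (intro subspace_add) auto
      ultimately show "space_of (restr M (p ` V)) = {X + Y |X Y. X \<in> e ` V \<and> Y \<in> d ` V}"
        by (auto simp: restr_def)
    qed
    then show False using ind by simp
  qed
  then consider "\<And>x. x \<in> V \<Longrightarrow> e x = 0" | "\<And>x. x \<in> V \<Longrightarrow> e x = p x"
  proof -
    have "e x = 0" if "e ` V = {0}" "x \<in> V" for x using that by (metis imageI singletonD)
    moreover have "e x = p x" if "d ` V = {0}" "x \<in> V" for x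
      using imageI[OF that(2), of d] that(1) by (simp add: d_def)
    ultimately show thesis using that \<open>\<not> (e ` V \<noteq> {0} \<and> d ` V \<noteq> {0})\<close> by blast
  qed
  then show ?thesis
  proof cases
    case 1
    then show ?thesis using fqp e(3) DV by metis
  next
    case 2
    then show ?thesis using fqp e(3) DV by metis
  qed
qed

text \<open>Idempotence on \<open>D\<close> doubles the \<open>q\<close> in front of the product,
  and one copy goes to each factor.\<close>

lemma nabla_idempotent:
  assumes q: "q \<in> centroid M" "\<And>x. x \<in> D \<Longrightarrow> q (q x) = q x" and XY: "X \<in> V" "Y \<in> V"
  shows "q (nab X Y) = nab (q X) (q Y)"
proof -
  have "q (nab X Y) = q (q (nab X Y))" using q(2) nabla_in_D XY by simp
  also have "\<dots> = q (nab X (q Y))" using XY by (simp add: centroid_right[OF q(1)])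
  also have "\<dots> = nab (q X) (q Y)" by (intro centroid_left q XY centroid_in[OF q(1)])
  finally show ?thesis .
qed

section \<open>Pairs of idempotents that agree on \<open>D\<close>\<close>

context
  fixes p q
  assumes p: "p \<in> centroid M" "\<And>x. x \<in> V \<Longrightarrow> p (p x) = p x"
    and q: "q \<in> centroid M" "\<And>x. x \<in> V \<Longrightarrow> q (q x) = q x"
    and pq: "\<And>x. x \<in> D \<Longrightarrow> p x = q x"
begin

lemma idempotents_diff_D:
  assumes "x \<in> V"
  shows "p x - q x \<in> D"
  using Ann_R_centroid[OF centroid_minus[OF p(1) q(1)] _ assms] pq Ann_R_sub_D by auto

text \<open>Says that \<open>p\<close> and \<open>q\<close> restrict to mutually inverse maps
  between their images. The vector \<open>a x - b (a x)\<close> lies in \<open>D\<close>, where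
  \<open>a\<close> and \<open>b\<close> agree; \<open>b\<close> kills it, hence so does
  \<open>a\<close>. Stating this for a generic pair gives both directions.\<close>

lemma idempotents_inverse:
  assumes x: "x \<in> V"
  shows "p (q (p x)) = p x" and "q (p (q x)) = q x"
proof -
  have *: "a (b (a x)) = a x"
    if a: "a \<in> centroid M" "\<And>x. x \<in> V \<Longrightarrow> a (a x) = a x"
      and b: "b \<in> centroid M" "\<And>x. x \<in> V \<Longrightarrow> b (b x) = b x"
      and ab: "\<And>x. x \<in> D \<Longrightarrow> a x = b x" and d: "\<And>x. x \<in> V \<Longrightarrow> a x - b x \<in> D" for a b
  proof -
    have V: "a x \<in> V" "b (a x) \<in> V" using x centroid_in[OF a(1)] centroid_in[OF b(1)] by auto
    have "a x - b (a x) \<in> D" using d[OF V(1)] a(2)[OF x] by simp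
    then have "a (a x - b (a x)) = b (a x - b (a x))" by (rule ab)
    also have "\<dots> = 0" using V b(2) by (simp add: centroid_diff[OF b(1)])
    finally show ?thesis using V a(2)[OF x] by (simp add: centroid_diff[OF a(1)])
  qed
  show "p (q (p x)) = p x"
    by (rule *[of p q, OF p q pq idempotents_diff_D])
  have "q x - p x \<in> D" if "x \<in> V" for x
    using subspace_diff[OF subspace_span, of 0 _ "p x - q x"] idempotents_diff_D[OF that]
      span_zero by (fastforce simp: nabla_span_def)
  then show "q (p (q x)) = q x"
    using *[of q p, OF q p pq[symmetric]] by blast
qed

text \<open>The inverse is \<open>p\<close>. The form is preserved because the defects
  \<open>X - q X\<close> and \<open>Y - q Y\<close> lie in \<open>D\<close>, where self-adjointness
  is available, and each is killed by one of the projections.\<close>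

lemma idempotents_isometry: "strong_isometry (restr M (p ` V)) (restr M (q ` V)) q"
proof -
  note id = strong_ideal_image[OF p(1)] nondegenerate_image[OF p(1), OF p(2)]
  note id' = strong_ideal_image[OF q(1)] nondegenerate_image[OF q(1), OF q(2)]
  have pV: "X \<in> V" "p X = X" "p (q X) = X" if "X \<in> p ` V" for X
    using that p(2) centroid_in[OF p(1)] idempotents_inverse(1) by auto
  have qV: "X \<in> V" "q X = X" "q (p X) = X" if "X \<in> q ` V" for X
    using that q(2) centroid_in[OF q(1)] idempotents_inverse(2) by auto
  have sp: "space_of (restr M h) = h" "form (restr M h) = form M" for h
    by (simp_all add: restr_def)
  have bij: "bij_betw q (p ` V) (q ` V)"
  proof (rule bij_betw_byWitness[where f' = p])
    show "\<forall>X\<in>p ` V. p (q X) = X" using pV(3) by blast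
    show "\<forall>X\<in>q ` V. q (p X) = X" using qV(3) by blast
    show "q ` p ` V \<subseteq> q ` V" "p ` q ` V \<subseteq> p ` V" using pV(1) qV(1) by blast+
  qed
  have lin: "linear_between (p ` V) (q ` V) q"
    unfolding linear_between_def
  proof (intro conjI ballI allI image_subsetI)
    fix x y assume x: "x \<in> p ` V" and y: "y \<in> p ` V"
    show "q x \<in> q ` V" using pV(1)[OF x] by simp
    show "q (x + y) = q x + q y" using pV(1) x y by (intro centroid_add q)
    show "q (c *\<^sub>R x) = c *\<^sub>R q x" for c using pV(1) x by (intro centroid_scale q)
  qed
  have nab: "q (nabla (restr M (p ` V)) X Y) = nabla (restr M (q ` V)) (q X) (q Y)"
    if XY: "X \<in> p ` V" "Y \<in> p ` V" for X Y
  proof -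
    have "q X \<in> q ` V" "q Y \<in> q ` V" using XY pV(1) by auto
    then show ?thesis
      using restr_strong_ideal(2)[OF M id XY] restr_strong_ideal(2)[OF M id', of "q X" "q Y"]
        nabla_idempotent[OF q(1), OF q(2)[OF subsetD[OF D_sub]] pV(1)[OF XY(1)] pV(1)[OF XY(2)]]
      by simp
  qed
  have "form M (q X) (q Y) = form M X Y" if XY: "X \<in> p ` V" "Y \<in> p ` V" for X Y
  proof -
    note X = pV[OF XY(1)] and Y = pV[OF XY(2)]
    have in': "q X \<in> V" "q Y \<in> V" using X(1) Y(1) centroid_in[OF q(1)] by auto
    have d: "X - q X \<in> D" "Y - q Y \<in> D"
      using idempotents_diff_D X(1,2) Y(1,2) by metis+
    have dV: "Y - q Y \<in> V" using d D_sub by blast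
    have 0: "form M 0 Z = 0" if "Z \<in> V" for Z
      using linear_between_0[OF form_linear_left[OF that] F(1)] .
    \<comment> \<open>Since \<open>Y = p Y\<close>, self-adjointness of \<open>p\<close> makes the
      first defect orthogonal to \<open>Y\<close>.\<close>
    have "p (X - q X) = 0" using X in' by (simp add: centroid_diff[OF p(1)])
    then have "form M (X - q X) Y = 0"
      using centroid_self_adjoint[OF p(1) d(1) Y(1)] Y 0 by simp
    then have "form M (q X) Y = form M X Y"
      using linear_between_diff[OF form_linear_left[OF Y(1)] F(1) X(1) in'(1)] by simp
    \<comment> \<open>Likewise \<open>q X\<close> is fixed by \<open>q\<close>, so self-adjointness
      of \<open>q\<close> makes the second defect orthogonal to \<open>q X\<close>.\<close>
    moreover have "q (Y - q Y) = 0" using Y(1) in' q(2) by (simp add: centroid_diff[OF q(1)])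
    then have "form M (Y - q Y) (q X) = 0"
      using centroid_self_adjoint[OF q(1) d(2) in'(1)] q(2)[OF X(1)] 0[OF in'(1)] by simp
    then have "form M (q X) (q Y) = form M (q X) Y"
      using linear_between_diff[OF form_linear[OF in'(1)] F(1) Y(1) in'(2)] F(9)[OF dV in'(1)]
      by simp
    ultimately show ?thesis by simp
  qed
  then show ?thesis
    unfolding strong_isometry_def strong_isomorphism_def sp using bij lin nab by blast
qed

end

section \<open>Matching the factors of two decompositions\<close>

context
  fixes I :: "'i set" and G :: "'i \<Rightarrow> 'a set"
  assumes I: "finite I" and dec: "indecomposable_decomposition M I G"
begin

lemma decomposition_direct_sum: "is_direct_sum V I G"
  using dec by (simp add: indecomposable_decomposition_def)

lemmas decomposition_component = component_component[OF I decomposition_direct_sum]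
lemmas decomposition_decompose = direct_sum_decompose[OF I decomposition_direct_sum]

lemma decomposition_centroid: "i \<in> I \<Longrightarrow> component I G i \<in> centroid M"
  using dec by (intro component_centroid I decomposition_direct_sum)
    (auto simp: indecomposable_decomposition_def)

lemma decomposition_component2:
  "i \<in> I \<Longrightarrow> k \<in> I \<Longrightarrow> x \<in> V \<Longrightarrow>
     component I G i (component I G k x) = (if i = k then component I G k x else 0)"
  using decomposition_component decomposition_decompose(1) by blast

lemma decomposition_idempotent:
  "i \<in> I \<Longrightarrow> x \<in> V \<Longrightarrow> component I G i (component I G i x) = component I G i x"
  by (simp add: decomposition_component2)

lemma decomposition_image:
  assumes i: "i \<in> I"
  shows "component I G i ` V = G i"
proof
  show "component I G i ` V \<subseteq> G i" using decomposition_decompose(1) i by blast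
  show "G i \<subseteq> component I G i ` V"
  proof
    fix x assume x: "x \<in> G i"
    then have "x \<in> V" using direct_sum_component_sub[OF I decomposition_direct_sum i] by blast
    then show "x \<in> component I G i ` V"
      using imageI[of x V "component I G i"] decomposition_component[OF i i x] by simp
  qed
qed

lemma decomposition_nonzero_on_D: "i \<in> I \<Longrightarrow> \<exists>x\<in>D. component I G i x \<noteq> 0"
  using dec decomposition_centroid decomposition_idempotent decomposition_image
  by (intro idempotent_nonzero_on_D) (auto simp: indecomposable_decomposition_def)

lemma decomposition_indecomposable:
  "i \<in> I \<Longrightarrow> indecomposable (restr M (component I G i ` V))"
  using dec decomposition_image by (simp add: indecomposable_decomposition_def)

end

lemma decomposition_match:
  assumes I: "finite I" "indecomposable_decomposition M I G"
    and J: "finite J" "indecomposable_decomposition M J H" and i: "i \<in> I"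
  shows "\<exists>j\<in>J. \<forall>x\<in>D. component I G i x = component J H j x"
proof -
  let ?p = "component I G i" and ?q = "component J H"
  note p = decomposition_centroid[OF I i] decomposition_idempotent[OF I i]
  note q = decomposition_centroid[OF J] decomposition_idempotent[OF J]
  obtain x where x: "x \<in> D" "?p x \<noteq> 0" using decomposition_nonzero_on_D[OF I i] by blast
  have xV: "x \<in> V" using x D_sub by blast
  have "(\<Sum>j\<in>J. ?q j (?p x)) = ?p x"
    by (rule decomposition_decompose(2)[OF J centroid_in[OF p(1) xV]])
  \<comment> \<open>The components of the non-zero vector \<open>?p x\<close> sum to it, so they
    cannot all vanish; this selects the partner of \<open>i\<close>.\<close>
  then obtain j where j: "j \<in> J" "?q j (?p x) \<noteq> 0" using x(2) by (metis sum.neutral)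
  have com: "?p (?q j y) = ?q j (?p y)" if "y \<in> D" for y
    using centroid_commute_on_D[OF p(1) q(1)[OF j(1)] that] .
  \<comment> \<open>The dichotomy is applied with both role assignments, first for the factor
    \<open>G i\<close> and then for \<open>H j\<close>; the vector \<open>x\<close> excludes the
    zero alternative each time. As the projections commute on \<open>D\<close>, they agree
    there.\<close>
  have "\<forall>y\<in>D. ?q j (?p y) = ?p y"
    using indecomposable_dichotomy[of ?p "?q j", OF p q[OF j(1)]
        decomposition_indecomposable[OF I i]] j x by blast
  moreover have "\<forall>y\<in>D. ?p (?q j y) = ?q j y"
    using indecomposable_dichotomy[of "?q j" ?p, OF q[OF j(1)] p
        decomposition_indecomposable[OF J j(1)]] j x com by metis
  ultimately show ?thesis using j com by metis
qed

text \<open>Projections of one decomposition with distinct indices compose to zero, so agreement on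
  \<open>D\<close> would make both vanish on \<open>D\<close>.\<close>

lemma decomposition_match_unique:
  assumes I: "finite I" "indecomposable_decomposition M I G" and ij: "i \<in> I" "j \<in> I"
    and eq: "\<And>x. x \<in> D \<Longrightarrow> component I G i x = component I G j x"
  shows "i = j"
proof (rule ccontr)
  assume "i \<noteq> j"
  obtain x where x: "x \<in> D" "component I G i x \<noteq> 0"
    using decomposition_nonzero_on_D[OF I ij(1)] by blast
  then have "x \<in> V" using D_sub by blast
  then have "component I G i (component I G j x) = 0"
    using \<open>i \<noteq> j\<close> ij by (simp add: decomposition_component2[OF I])
  then show False
    using eq[OF x(1)] x(2) decomposition_idempotent[OF I ij(1) \<open>x \<in> V\<close>] by simp
qed

text \<open>Uniqueness of partners, applied in the first decomposition, gives injectivity; applied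
  in the second, after matching \<open>j\<close> back to some \<open>i\<close>, it gives
  surjectivity.\<close>

lemma decomposition_bij:
  assumes I: "finite I" "indecomposable_decomposition M I G"
    and J: "finite J" "indecomposable_decomposition M J H"
  obtains \<sigma> where "bij_betw \<sigma> I J"
    and "\<And>i x. i \<in> I \<Longrightarrow> x \<in> D \<Longrightarrow> component I G i x = component J H (\<sigma> i) x"
proof -
  have "\<forall>i\<in>I. \<exists>j\<in>J. \<forall>x\<in>D. component I G i x = component J H j x"
    using decomposition_match[OF I J] by blast
  then obtain \<sigma> where \<sigma>: "\<And>i. i \<in> I \<Longrightarrow> \<sigma> i \<in> J"
    "\<And>i x. i \<in> I \<Longrightarrow> x \<in> D \<Longrightarrow> component I G i x = component J H (\<sigma> i) x"
    by metis
  have "inj_on \<sigma> I"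
    by (rule inj_onI, rule decomposition_match_unique[OF I]) (use \<sigma>(2) in auto)
  moreover have "j \<in> \<sigma> ` I" if j: "j \<in> J" for j
  proof -
    obtain i where i: "i \<in> I" "\<forall>x\<in>D. component J H j x = component I G i x"
      using decomposition_match[OF J I j] by blast
    then have "j = \<sigma> i"
      by (intro decomposition_match_unique[OF J j]) (use \<sigma> in auto)
    then show ?thesis using i by blast
  qed
  ultimately have "bij_betw \<sigma> I J" using \<sigma>(1) by (auto simp: bij_betw_def)
  then show ?thesis using that \<sigma>(2) by blast
qed

section \<open>Two decompositions matched index by index\<close>

context
  fixes I :: "'i set" and G H :: "'i \<Rightarrow> 'a set"
  assumes I: "finite I" and G: "indecomposable_decomposition M I G"
    and H: "indecomposable_decomposition M I H"
    and GH: "\<And>i x. i \<in> I \<Longrightarrow> x \<in> D \<Longrightarrow> component I G i x = component I H i x"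
begin

text \<open>Letting \<open>A\<close> and \<open>B\<close> range over both decompositions covers all
  the span equalities at once. The spans involve projections of products only, and on
  \<open>D\<close> the two families coincide.\<close>

lemma matched_nabla_span:
  assumes i: "i \<in> I" and j: "j \<in> I" and A: "A \<in> {G, H}" and B: "B \<in> {G, H}"
  shows "nabla_span M (A i) (B j) = (if i = j then nabla_span M (G i) (G i) else {0})"
proof -
  note c = decomposition_centroid[OF I]
  have dA: "indecomposable_decomposition M I A" and dB: "indecomposable_decomposition M I B"
    using A B G H by auto
  have AD: "component I A i x = component I G i x" if "x \<in> D" for x
    using A GH[OF i that] by auto
  have BD: "component I B j x = component I G j x" if "x \<in> D" for x
    using B GH[OF j that] by auto
  have span: "nabla_span M (A i) (B j) =
      span {component I A i (component I B j (nab X Y)) | X Y. X \<in> V \<and> Y \<in> V}"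
    using nabla_span_image[OF c[OF dA i] c[OF dB j]] decomposition_image[OF I dA i]
      decomposition_image[OF I dB j] by simp
  have spanG: "nabla_span M (G i) (G i) =
      span {component I G i (component I G i (nab X Y)) | X Y. X \<in> V \<and> Y \<in> V}"
    using nabla_span_image[OF c[OF G i] c[OF G i]] decomposition_image[OF I G i] by simp
  have eq: "component I A i (component I B j (nab X Y))
      = (if i = j then component I G i (component I G i (nab X Y)) else 0)"
    if "X \<in> V" "Y \<in> V" for X Y
  proof -
    have D: "nab X Y \<in> D" and V: "nab X Y \<in> V" using nabla_in_D nabla_in that by auto
    have "component I A i (component I B j (nab X Y))
        = component I G i (component I G j (nab X Y))"
      using AD BD D centroid_D[OF c[OF G j] D] by simp
    then show ?thesis using decomposition_component2[OF I G i j V]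
        decomposition_component2[OF I G i i V] by (cases "i = j") simp_all
  qed
  show ?thesis
  proof (cases "i = j")
    case True
    then have "{component I A i (component I B j (nab X Y)) | X Y. X \<in> V \<and> Y \<in> V} =
        {component I G i (component I G i (nab X Y)) | X Y. X \<in> V \<and> Y \<in> V}"
      using eq by force
    then show ?thesis using span spanG True by simp
  next
    case False
    then have "{component I A i (component I B j (nab X Y)) | X Y. X \<in> V \<and> Y \<in> V} \<subseteq> {0}"
      using eq by auto
    then have "nabla_span M (A i) (B j) \<subseteq> {0}"
      unfolding span by (rule span_minimal) simp
    then show ?thesis using False span_zero by (auto simp: span)
  qed
qed

lemma matched_isometry:
  assumes i: "i \<in> I"
  shows "strong_isometry (restr M (G i)) (restr M (H i)) (component I H i)"
  using idempotents_isometry[of "component I G i" "component I H i",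
      OF decomposition_centroid[OF I G i] decomposition_idempotent[OF I G i]
      decomposition_centroid[OF I H i] decomposition_idempotent[OF I H i] GH[OF i]]
  by (simp add: decomposition_image[OF I G i] decomposition_image[OF I H i])

lemma matched_inverse:
  assumes i: "i \<in> I" and x: "x \<in> V"
  shows "component I G i (component I H i (component I G i x)) = component I G i x"
    and "component I H i (component I G i (component I H i x)) = component I H i x"
  using idempotents_inverse[of "component I G i" "component I H i",
      OF decomposition_centroid[OF I G i] decomposition_idempotent[OF I G i]
      decomposition_centroid[OF I H i] decomposition_idempotent[OF I H i] GH[OF i] x] by auto

lemma matched_automorphism: "strong_automorphism M (direct_sum_map I G (component I H))"
proof -
  let ?p = "component I G" and ?q = "component I H"
  let ?f = "\<lambda>v. \<Sum>i\<in>I. ?q i (?p i v)" and ?g = "\<lambda>v. \<Sum>i\<in>I. ?p i (?q i v)"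
  note p = decomposition_centroid[OF I G] and q = decomposition_centroid[OF I H]
  have f: "?f \<in> centroid M" and g: "?g \<in> centroid M"
    by (rule centroid_sum, rule centroid_comp[OF q p], assumption+)
      (rule centroid_sum, rule centroid_comp[OF p q], assumption+)
  \<comment> \<open>The \<open>i\<close>-th component of the inner sum is its \<open>i\<close>-th
    summand, so the composite collapses to the sum of the components of \<open>v\<close>. Stated for
    generic \<open>A\<close> and \<open>B\<close>, it makes \<open>?f\<close> and \<open>?g\<close>
    inverse on both sides.\<close>
  have inv: "(\<Sum>i\<in>I. component I A i (component I B i
        (\<Sum>i\<in>I. component I B i (component I A i v)))) = v"
    if v: "v \<in> V" and A: "indecomposable_decomposition M I A"
      and B: "indecomposable_decomposition M I B"
      and AB: "\<And>i. i \<in> I \<Longrightarrow>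
        component I A i (component I B i (component I A i v)) = component I A i v" for v A B
  proof -
    have "component I B i (\<Sum>i\<in>I. component I B i (component I A i v))
        = component I B i (component I A i v)" if i: "i \<in> I" for i
      by (rule component_sum[OF I decomposition_direct_sum[OF I B] _ i])
        (use decomposition_decompose(1)[OF I B] centroid_in[OF decomposition_centroid[OF I A] v]
         in auto)
    then have "(\<Sum>i\<in>I. component I A i (component I B i
        (\<Sum>i\<in>I. component I B i (component I A i v)))) = (\<Sum>i\<in>I. component I A i v)"
      using AB by (intro sum.cong) auto
    then show ?thesis using decomposition_decompose(2)[OF I A v] by simp
  qed
  have "bij_betw ?f V V"
    by (rule bij_betw_byWitness[where f' = ?g])
      (use inv[OF _ G H] inv[OF _ H G] matched_inverse centroid_in[OF f] centroid_in[OF g] in auto)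
  \<comment> \<open>Being the identity on \<open>D\<close>, the map is idempotent there, so
    \<open>nabla_idempotent\<close> yields compatibility with the product.\<close>
  moreover have fD: "?f x = x" if x: "x \<in> D" for x
  proof -
    have xV: "x \<in> V" using x D_sub by blast
    have "?f x = (\<Sum>i\<in>I. ?p i x)"
    proof (rule sum.cong)
      fix i assume i: "i \<in> I"
      show "?q i (?p i x) = ?p i x"
        using GH[OF i x] decomposition_idempotent[OF I H i xV] by simp
    qed simp
    then show ?thesis using decomposition_decompose(2)[OF I G xV] by simp
  qed
  have "?f (nab X Y) = nab (?f X) (?f Y)" if "X \<in> V" "Y \<in> V" for X Y
    by (rule nabla_idempotent[OF f _ that]) (simp add: fD)
  ultimately show ?thesis
    using centroid_linear[OF f]
    unfolding strong_isomorphism_def direct_sum_map_def by blast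
qed

end

end

section \<open>Reordering a decomposition, and the conclusion\<close>

lemma direct_sum_reindex:
  fixes \<sigma> :: "'i \<Rightarrow> 'j" and G :: "'j \<Rightarrow> 'v::real_vector set"
  assumes \<sigma>: "bij_betw \<sigma> I J" and J: "is_direct_sum V J G"
  shows "is_direct_sum V I (\<lambda>i. G (\<sigma> i))"
proof -
  have J0: "\<forall>j\<in>J. y j = 0" if "\<forall>j\<in>J. y j \<in> G j" "(\<Sum>j\<in>J. y j) = 0" for y
    using J that unfolding is_direct_sum_def by blast
  define \<tau> where "\<tau> = inv_into I \<sigma>"
  have \<tau>: "\<tau> j \<in> I" "\<sigma> (\<tau> j) = j" if "j \<in> J" for j
    using \<sigma> that unfolding \<tau>_def bij_betw_def by (auto intro: inv_into_into f_inv_into_f)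
  have \<sigma>': "\<sigma> i \<in> J" "\<tau> (\<sigma> i) = i" if "i \<in> I" for i
    using \<sigma> that unfolding \<tau>_def bij_betw_def by auto
  have sum\<tau>: "(\<Sum>j\<in>J. x (\<tau> j)) = (\<Sum>i\<in>I. x i)" for x :: "'i \<Rightarrow> 'v"
    by (rule sum.reindex_bij_witness[of _ \<sigma> \<tau>]) (use \<tau> \<sigma>' in auto)
  have sum\<sigma>: "(\<Sum>i\<in>I. x (\<sigma> i)) = (\<Sum>j\<in>J. x j)" for x :: "'j \<Rightarrow> 'v"
    by (rule sum.reindex_bij_betw[OF \<sigma>])
  have "sum_subspaces J G = sum_subspaces I (\<lambda>i. G (\<sigma> i))"
  proof (intro set_eqI iffI)
    fix v assume "v \<in> sum_subspaces J G"
    then obtain x where "\<forall>j\<in>J. x j \<in> G j" "v = (\<Sum>j\<in>J. x j)" by (auto simp: sum_subspaces_def)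
    then show "v \<in> sum_subspaces I (\<lambda>i. G (\<sigma> i))"
      unfolding sum_subspaces_def using \<sigma>'(1) sum\<sigma>[of x]
      by (intro CollectI exI[of _ "\<lambda>i. x (\<sigma> i)"]) auto
  next
    fix v assume "v \<in> sum_subspaces I (\<lambda>i. G (\<sigma> i))"
    then obtain x where "\<forall>i\<in>I. x i \<in> G (\<sigma> i)" "v = (\<Sum>i\<in>I. x i)"
      by (auto simp: sum_subspaces_def)
    then show "v \<in> sum_subspaces J G"
      unfolding sum_subspaces_def using \<tau> sum\<tau>[of x]
      by (intro CollectI exI[of _ "\<lambda>j. x (\<tau> j)"]) (auto, metis)
  qed
  moreover have "\<forall>i\<in>I. x i = 0" if x: "\<forall>i\<in>I. x i \<in> G (\<sigma> i)" "(\<Sum>i\<in>I. x i) = 0" for x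
  proof -
    have "\<forall>j\<in>J. x (\<tau> j) \<in> G j" using x(1) \<tau> by metis
    moreover have "(\<Sum>j\<in>J. x (\<tau> j)) = 0" using x(2) sum\<tau> by simp
    ultimately have "\<forall>j\<in>J. x (\<tau> j) = 0" by (rule J0)
    then show ?thesis using \<sigma>' by metis
  qed
  moreover have "\<forall>i\<in>I. subspace (G (\<sigma> i))" "V = sum_subspaces J G"
    using J \<sigma>'(1) by (auto simp: is_direct_sum_def)
  ultimately show ?thesis unfolding is_direct_sum_def by (intro conjI allI impI) auto
qed

text \<open>The two projections are defined along complements formed over different index sets. On
  \<open>V\<close> they are compared through the family of components of \<open>v\<close>, which
  represents \<open>v\<close> in either indexing.\<close>

lemma component_reindex:
  assumes \<sigma>: "bij_betw \<sigma> I J" and J: "finite J" "is_direct_sum V J G" and "i \<in> I" and "v \<in> V"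
  shows "component I (\<lambda>i. G (\<sigma> i)) i v = component J G (\<sigma> i) v"
proof -
  have I: "finite I" using \<sigma> J(1) bij_betw_finite by blast
  have "\<And>i. i \<in> I \<Longrightarrow> \<sigma> i \<in> J" using \<sigma> by (auto simp: bij_betw_def)
  then have "component I (\<lambda>i. G (\<sigma> i)) i (\<Sum>i\<in>I. component J G (\<sigma> i) v)
      = component J G (\<sigma> i) v"
    using direct_sum_decompose(1)[OF J] assms
    by (intro component_sum[OF I direct_sum_reindex[OF \<sigma> J(2)]]) auto
  moreover have "(\<Sum>i\<in>I. component J G (\<sigma> i) v) = v"
    using sum.reindex_bij_betw[OF \<sigma>, of "\<lambda>j. component J G j v"]
      direct_sum_decompose(2)[OF J \<open>v \<in> V\<close>] by simp
  ultimately show ?thesis by simp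
qed

theorem theorem3p5:
  fixes M :: "'a::real_vector mla"
    and n m :: nat
    and G G' :: "nat \<Rightarrow> 'a set"
  assumes "metric_lie_algebra M"
    and "totally_isotropic M (Ann_R M)"
    and "indecomposable_decomposition M {1..n} G"
    and "indecomposable_decomposition M {1..m} G'"
  shows "n = m \<and> (\<exists>\<sigma>. bij_betw \<sigma> {1..n} {1..n} \<and>
    (let H = (\<lambda>i. G' (\<sigma> i)); \<pi> = (\<lambda>i. component {1..n} H i) in
      (\<forall>i\<in>{1..n}.
         nabla_span M (G i) (G i) = nabla_span M (G i) (H i) \<and>
         nabla_span M (G i) (H i) = nabla_span M (H i) (G i) \<and>
         nabla_span M (H i) (G i) = nabla_span M (H i) (H i)) \<and>
      (\<forall>i\<in>{1..n}. \<forall>j\<in>{1..n}. i \<noteq> j \<longrightarrow>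
         nabla_span M (G i) (H j) = {0} \<and> nabla_span M (H j) (G i) = {0}) \<and>
      (\<forall>i\<in>{1..n}. strong_isometry (restr M (G i)) (restr M (H i)) (\<pi> i)) \<and>
      strong_automorphism M (direct_sum_map {1..n} G \<pi>)))"
proof -
  interpret isotropic_metric_lie M by unfold_locales (use assms in auto)
  obtain \<sigma> where \<sigma>: "bij_betw \<sigma> {1..n} {1..m}"
    and GG': "\<And>i x. i \<in> {1..n} \<Longrightarrow> x \<in> D \<Longrightarrow>
        component {1..n} G i x = component {1..m} G' (\<sigma> i) x"
    using decomposition_bij[OF _ assms(3) _ assms(4)] by (metis finite_atLeastAtMost)
  \<comment> \<open>With equal cardinalities the matching \<open>\<sigma>\<close> becomes a
    permutation of \<open>{1..n}\<close>.\<close>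
  have nm: "n = m" using bij_betw_same_card[OF \<sigma>] by simp
  define H where "H i = G' (\<sigma> i)" for i
  have ds: "is_direct_sum V {1..m} G'"
    using assms(4) by (simp add: indecomposable_decomposition_def)
  have "\<And>i. i \<in> {1..n} \<Longrightarrow> \<sigma> i \<in> {1..m}" using \<sigma> by (auto simp: bij_betw_def)
  then have H: "indecomposable_decomposition M {1..n} H"
    using assms(4) direct_sum_reindex[OF \<sigma> ds]
    unfolding indecomposable_decomposition_def H_def by blast
  have GH: "component {1..n} G i x = component {1..n} H i x" if "i \<in> {1..n}" "x \<in> D" for i x
    using GG'[OF that] component_reindex[OF \<sigma> _ ds that(1)] that(2) D_sub
    unfolding H_def by (simp add: subset_iff)
  note fin = finite_atLeastAtMost[of 1 n]
  note span = matched_nabla_span[OF fin assms(3) H GH]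
  have diag: "\<forall>i\<in>{1..n}.
      nabla_span M (G i) (G i) = nabla_span M (G i) (H i) \<and>
      nabla_span M (G i) (H i) = nabla_span M (H i) (G i) \<and>
      nabla_span M (H i) (G i) = nabla_span M (H i) (H i)"
    using span[of _ _ G H] span[of _ _ H G] span[of _ _ H H] by simp
  have off: "\<forall>i\<in>{1..n}. \<forall>j\<in>{1..n}. i \<noteq> j \<longrightarrow>
      nabla_span M (G i) (H j) = {0} \<and> nabla_span M (H j) (G i) = {0}"
    using span[of _ _ G H] span[of _ _ H G] by simp
  have isom: "\<forall>i\<in>{1..n}.
      strong_isometry (restr M (G i)) (restr M (H i)) (component {1..n} H i)"
    using matched_isometry[OF fin assms(3) H GH] by blast
  have aut: "strong_automorphism M (direct_sum_map {1..n} G (component {1..n} H))"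
    by (rule matched_automorphism[OF fin assms(3) H GH])
  have H': "H = (\<lambda>i. G' (\<sigma> i))" by (rule ext) (rule H_def)
  show ?thesis
    unfolding Let_def
    by (rule conjI[OF nm], rule exI[of _ \<sigma>],
        intro conjI diag[unfolded H'] off[unfolded H'] isom[unfolded H'] aut[unfolded H'])
      (use \<sigma> nm in simp)
qed

end
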